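(* Let $m\ge 1$. For all $k\ge 1$, the polynomials $(-1)^kR_{k+1}(\mathbf p;-\mathbf q)$ and $(-1)^kG_k(\mathbf p;-\mathbf q)$ in the indeterminates $p_1,\dots,p_m,q_1,\dots,q_m$ are $\mathbf p,\mathbf q$-positive. That is, the terms of highest degree in $(-1)^kF_k(\mathbf p;-\mathbf q)$ all have positive coefficients.
   Context: Fix $m\ge1$ and indeterminates $\mathbf p=(p_1,\dots,p_m)$, $\mathbf q=(q_1,\dots,q_m)$; write $-\mathbf q=(-q_1,\dots,-q_m)$. "Degree" is total degree in the $p$'s and $q$'s. Normalized character: for partitions $\omega\vdash n$ and $1\le k\le n$, $\widehat\chi_\omega(k\,1^{n-k})=n(n-1)\cdots(n-k+1)\,\chi_\omega(k\,1^{n-k})/\chi_\omega(1^n)$, where $\chi_\omega(\lambda)$ is the irreducible character of the symmetric group $\mathfrak S_n$ indexed by $\omega$ evaluated on the class of cycle type $\lambda$, and $k\,1^{n-k}$ is the cycle type of a $k$-cycle. Shape $\mathbf p\times\mathbf q$: for positive integers $p_1,\dots,p_m$ and integers $q_1>q_2>\cdots>q_m>0$, $\mathbf p\times\mathbf q$ is the partition of $n=\sum_i p_iq_i$ having exactly $p_i$ parts equal to $q_i$ for $i=1,\dots,m$. Stanley's character polynomial $F_k(\mathbf p;\mathbf q)=F_k(p_1,\dots,p_m;q_1,\dots,q_m)$ is the (unique) polynomial in the $p$'s and $q$'s with $F_k(\mathbf p;\mathbf q)=\widehat\chi_{\mathbf p\times\mathbf q}(k\,1^{n-k})$ for all such integer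 values with $n\ge k$. $F_k(\mathbf p;-\mathbf q)$ is obtained by replacing each $q_i$ by $-q_i$. The polynomial $F_k$ has degree $k+1$, and $G_k(\mathbf p;\mathbf q)$ denotes the sum of its terms of degree $k+1$ (the terms of highest degree). The polynomials $R_i(\mathbf p;\mathbf q)$ are defined by $R_{\mathbf p;\mathbf q}(z)=\sum_{i\ge0}R_i(\mathbf p;\mathbf q)z^i=\dfrac{z}{h^{\langle-1\rangle}(z)}$, where $\langle-1\rangle$ denotes compositional inverse of formal power series in $z$ and $$h(z)=\frac{z\prod_{i=1}^m\left(1-\left(q_i-\sum_{j=1}^{i}p_j\right)z\right)}{\left(1+\sum_{j=1}^mp_jz\right)\prod_{i=1}^m\left(1-\left(q_i-\sum_{j=1}^{i-1}p_j\right)z\right)}.$$ $R_i(\mathbf p;-\mathbf q)$ and $G_k(\mathbf p;-\mathbf q)$ are obtained by replacing each $q_i$ by $-q_i$. A polynomial in the $p$'s and $q$'s is called $\mathbf p,\mathbf q$-positive if the coefficients of all its terms (i.e. all its nonzero coefficients) are positive. *)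

theory Defs
  imports Complex_Main
    "HOL-Library.Poly_Mapping"
    "HOL-Combinatorics.Combinatorics"
    "HOL-Computational_Algebra.Formal_Power_Series"
begin

section \<open>Polynomials in the indeterminates p and q\<close>

text \<open>The indeterminates $p_i$ and $q_i$; only indices $1 \le i \le m$ are used. A monomial is a
  finitely supported exponent function, a polynomial a finitely supported coefficient function on
  monomials; the ring structure is the one of \<^theory>\<open>HOL-Library.Poly_Mapping\<close>.\<close>

datatype pq_var = PVar nat | QVar nat

type_synonym pq_monom = "pq_var \<Rightarrow>\<^sub>0 nat"
type_synonym pq_poly = "pq_monom \<Rightarrow>\<^sub>0 rat"

definition Const :: "rat \<Rightarrow> pq_poly" where
  "Const c = Poly_Mapping.single 0 c"

definition Var :: "pq_var \<Rightarrow> pq_poly" where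
  "Var v = Poly_Mapping.single (Poly_Mapping.single v 1) 1"

abbreviation p_ind :: "nat \<Rightarrow> pq_poly" where "p_ind i \<equiv> Var (PVar i)"
abbreviation q_ind :: "nat \<Rightarrow> pq_poly" where "q_ind i \<equiv> Var (QVar i)"

definition pq_vars :: "nat \<Rightarrow> pq_var set" where
  "pq_vars m = PVar ` {1..m} \<union> QVar ` {1..m}"

definition polys_in :: "nat \<Rightarrow> pq_poly set" where
  "polys_in m = {f. \<forall>a \<in> Poly_Mapping.keys f. Poly_Mapping.keys a \<subseteq> pq_vars m}"

text \<open>Evaluation in a commutative ring, along a map \<open>\<phi>\<close> of the coefficients. It serves both for
  the numerical values of a polynomial and for the substitution of polynomials.\<close>

definition poly_eval ::
  "(rat \<Rightarrow> 'a) \<Rightarrow> (pq_var \<Rightarrow> 'a) \<Rightarrow> pq_poly \<Rightarrow> 'a::comm_ring_1" where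
  "poly_eval \<phi> x f = (\<Sum>a \<in> Poly_Mapping.keys f. \<phi> (Poly_Mapping.lookup f a) *
     (\<Prod>v \<in> Poly_Mapping.keys a. x v ^ Poly_Mapping.lookup a v))"

definition pq_point :: "(nat \<Rightarrow> nat) \<Rightarrow> (nat \<Rightarrow> nat) \<Rightarrow> pq_var \<Rightarrow> rat" where
  "pq_point p q v = (case v of PVar i \<Rightarrow> of_nat (p i) | QVar i \<Rightarrow> of_nat (q i))"

definition neg_q :: "pq_poly \<Rightarrow> pq_poly" where
  "neg_q f = poly_eval Const (\<lambda>v. case v of PVar i \<Rightarrow> p_ind i | QVar i \<Rightarrow> - q_ind i) f"

definition monom_degree :: "pq_monom \<Rightarrow> nat" where
  "monom_degree a = (\<Sum>v \<in> Poly_Mapping.keys a. Poly_Mapping.lookup a v)"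

definition total_degree :: "pq_poly \<Rightarrow> nat" where
  "total_degree f = Max (insert 0 (monom_degree ` Poly_Mapping.keys f))"

definition homogeneous_part :: "nat \<Rightarrow> pq_poly \<Rightarrow> pq_poly" where
  "homogeneous_part d f = (\<Sum>a \<in> {a \<in> Poly_Mapping.keys f. monom_degree a = d}.
     Poly_Mapping.single a (Poly_Mapping.lookup f a))"

definition pq_positive :: "pq_poly \<Rightarrow> bool" where
  "pq_positive f \<longleftrightarrow> (\<forall>a \<in> Poly_Mapping.keys f. Poly_Mapping.lookup f a > 0)"


section \<open>The polynomials R\<close>

text \<open>The coefficient ring is not a field, so quotient and compositional inverse of power series
  are given by their defining properties. They are only applied when the denominator is 1 plus
  higher terms, respectively when the series is $z$ plus higher terms, so that both exist and are
  unique.\<close>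

definition fps_quotient :: "'a::comm_ring_1 fps \<Rightarrow> 'a fps \<Rightarrow> 'a fps" where
  "fps_quotient f g = (THE r. r * g = f)"

definition fps_comp_inverse :: "'a::comm_ring_1 fps \<Rightarrow> 'a fps" where
  "fps_comp_inverse h = (THE g. fps_nth g 0 = 0 \<and> h oo g = fps_X \<and> g oo h = fps_X)"

definition h_series :: "nat \<Rightarrow> pq_poly fps" where
  "h_series m = fps_quotient
     (fps_X * (\<Prod>i = 1..m. 1 - fps_const (q_ind i - (\<Sum>j = 1..i. p_ind j)) * fps_X))
     ((1 + (\<Sum>j = 1..m. fps_const (p_ind j) * fps_X)) *
      (\<Prod>i = 1..m. 1 - fps_const (q_ind i - (\<Sum>j = 1..<i. p_ind j)) * fps_X))"

definition R_series :: "nat \<Rightarrow> pq_poly fps" where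
  "R_series m = fps_quotient fps_X (fps_comp_inverse (h_series m))"

definition R_poly :: "nat \<Rightarrow> nat \<Rightarrow> pq_poly" where
  "R_poly m i = fps_nth (R_series m) i"


section \<open>The group algebra of the symmetric group\<close>

text \<open>The symmetric group of degree $n$ is the set of permutations of \<open>{..<n}\<close> under composition;
  elements of its complex group algebra are finite formal sums of such permutations.
  The product of \<^theory>\<open>HOL-Library.Poly_Mapping\<close> is not used for this type.\<close>

type_synonym perm_alg = "(nat \<Rightarrow> nat) \<Rightarrow>\<^sub>0 complex"

definition sym_group :: "nat \<Rightarrow> (nat \<Rightarrow> nat) set" where
  "sym_group n = {\<sigma>. \<sigma> permutes {..<n}}"

definition group_algebra :: "nat \<Rightarrow> perm_alg set" where
  "group_algebra n = {x. Poly_Mapping.keys x \<subseteq> sym_group n}"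

definition alg_mult :: "perm_alg \<Rightarrow> perm_alg \<Rightarrow> perm_alg" where
  "alg_mult x y = (\<Sum>\<sigma> \<in> Poly_Mapping.keys x. \<Sum>\<tau> \<in> Poly_Mapping.keys y.
     Poly_Mapping.single (\<sigma> \<circ> \<tau>) (Poly_Mapping.lookup x \<sigma> * Poly_Mapping.lookup y \<tau>))"

definition alg_scale :: "complex \<Rightarrow> perm_alg \<Rightarrow> perm_alg" where
  "alg_scale c x = Poly_Mapping.map ((*) c) x"

lemma lookup_alg_scale [simp]:
  "Poly_Mapping.lookup (alg_scale c x) \<sigma> = c * Poly_Mapping.lookup x \<sigma>"
  by (simp add: alg_scale_def Poly_Mapping.map.rep_eq when_def)

global_interpretation perm_alg: vector_space alg_scale
  by unfold_locales
    (auto intro!: poly_mapping_eqI simp: lookup_add algebra_simps)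

text \<open>The trace of an endomorphism of a finite-dimensional subspace \<open>V\<close>, computed in some basis.\<close>

definition trace_on :: "perm_alg set \<Rightarrow> (perm_alg \<Rightarrow> perm_alg) \<Rightarrow> complex" where
  "trace_on V f =
     (let B = (SOME B. perm_alg.independent B \<and> perm_alg.span B = V)
      in \<Sum>b\<in>B. perm_alg.representation B (f b) b)"


section \<open>Irreducible characters of the symmetric group\<close>

text \<open>A partition is given by the list of its parts in weakly decreasing order. The cells of its
  diagram are pairs (row, column), and its cells in row-reading order are the tableau with entries
  $0, \dots, n-1$.\<close>

definition diagram_cells :: "nat list \<Rightarrow> (nat \<times> nat) list" where
  "diagram_cells \<omega> = concat (map (\<lambda>r. map (\<lambda>c. (r, c)) [0..<\<omega> ! r]) [0..<length \<omega>])"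

definition row_group :: "nat list \<Rightarrow> (nat \<Rightarrow> nat) set" where
  "row_group \<omega> = {\<sigma> \<in> sym_group (sum_list \<omega>).
     \<forall>j < sum_list \<omega>. fst (diagram_cells \<omega> ! \<sigma> j) = fst (diagram_cells \<omega> ! j)}"

definition column_group :: "nat list \<Rightarrow> (nat \<Rightarrow> nat) set" where
  "column_group \<omega> = {\<sigma> \<in> sym_group (sum_list \<omega>).
     \<forall>j < sum_list \<omega>. snd (diagram_cells \<omega> ! \<sigma> j) = snd (diagram_cells \<omega> ! j)}"

definition young_symmetrizer :: "nat list \<Rightarrow> perm_alg" where
  "young_symmetrizer \<omega> = (\<Sum>\<sigma> \<in> row_group \<omega>. \<Sum>\<tau> \<in> column_group \<omega>.
     Poly_Mapping.single (\<sigma> \<circ> \<tau>) (of_int (sign \<tau>)))"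

text \<open>The Specht module, as a left ideal of the group algebra. With this convention the
  partition $(n)$ gives the trivial representation and $(1^n)$ the sign representation.\<close>

definition specht_module :: "nat list \<Rightarrow> perm_alg set" where
  "specht_module \<omega> = (\<lambda>x. alg_mult x (young_symmetrizer \<omega>)) ` group_algebra (sum_list \<omega>)"

definition irr_character :: "nat list \<Rightarrow> (nat \<Rightarrow> nat) \<Rightarrow> complex" where
  "irr_character \<omega> \<sigma> = trace_on (specht_module \<omega>) (alg_mult (Poly_Mapping.single \<sigma> 1))"

text \<open>The class of cycle type $k\,1^{n-k}$ is represented by the cycle on $0, \dots, k-1$.\<close>

definition normalized_character :: "nat list \<Rightarrow> nat \<Rightarrow> complex" where
  "normalized_character \<omega> k =
     (\<Prod>i<k. of_nat (sum_list \<omega> - i)) *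
     irr_character \<omega> (cycle_of_list [0..<k]) / irr_character \<omega> id"


section \<open>The character polynomial\<close>

definition shape :: "nat \<Rightarrow> (nat \<Rightarrow> nat) \<Rightarrow> (nat \<Rightarrow> nat) \<Rightarrow> nat list" where
  "shape m p q = concat (map (\<lambda>i. replicate (p i) (q i)) [1..<Suc m])"

definition admissible :: "nat \<Rightarrow> (nat \<Rightarrow> nat) \<Rightarrow> (nat \<Rightarrow> nat) \<Rightarrow> bool" where
  "admissible m p q \<longleftrightarrow> (\<forall>i \<in> {1..m}. p i > 0 \<and> q i > 0) \<and>
     (\<forall>i \<in> {1..m}. \<forall>j \<in> {1..m}. i < j \<longrightarrow> q i > q j)"

definition F_poly :: "nat \<Rightarrow> nat \<Rightarrow> pq_poly" where
  "F_poly m k = (THE f. f \<in> polys_in m \<and>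
     (\<forall>p q. admissible m p q \<and> k \<le> (\<Sum>i = 1..m. p i * q i) \<longrightarrow>
        of_rat (poly_eval id (pq_point p q) f) = normalized_character (shape m p q) k))"

definition G_poly :: "nat \<Rightarrow> nat \<Rightarrow> pq_poly" where
  "G_poly m k = homogeneous_part (k + 1) (F_poly m k)"

end

theory Submission
  imports Defs "HOL-Computational_Algebra.Polynomial"
begin

text \<open>The Young symmetrizer e satisfies e * e = c e, so the trace of \<pi> on the Specht module can be
  computed on the whole group algebra; the normalized character becomes a signed sum over pairs of
  an injective placement of {0..<k} in the diagram and a factorization \<sigma> \<tau> of the
  k-cycle such that \<sigma> preserves the rows and \<tau> the columns of the placement.
  Non-injective placements may be included, because their contributions cancel under (\<sigma>,
  \<tau>) \<mapsto> (\<sigma> (a b), (a b) \<tau>). For the shape p \<times> q the placements are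
  then counted independently on the orbits of \<sigma> and \<tau>: an orbit of \<sigma>
  contributes some p_i, an orbit of \<tau> some q_i. This is a polynomial formula for F, in which
  every monomial of (-1)^k F(p; -q) has the sign (-1)^k times the sign of \<tau> times
  (-1)^(number of orbits of \<tau>), which is +1. So all of (-1)^k F(p; -q) is positive, and in
  particular its terms of highest degree.

  For R, let g be the compositional inverse of h and write z / h(z) = 1 + z \<Phi>(z). Then g = z
  (1 + g \<Phi>(g)) and z / g = 1 - z \<Phi>(g). After telescoping, \<Phi> is a sum of products of
  geometric series with visible signs, and the coefficients of g, hence those of \<Phi>(g),
  inherit their signs through the recursion for g.\<close>

section \<open>Evaluation, positivity and uniqueness of polynomials\<close>

text \<open>Several obstacles shape the details. \<open>F_poly\<close> is a definite description, so
  the formula identifies it only once a polynomial vanishing at all admissible points with n \<ge> k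
  is known to be zero; these points obey q_1 > ... > q_m, which the substitution must respect.
  Injectivity of a placement would couple different orbits. Only for arbitrary maps of {0..<k} into
  the diagram do the counts, for a fixed choice of row blocks, become products over orbits; this is
  what the cancellation is for. The constant c is never computed: the trace formula at the identity
  gives c times the dimension = n!, so c is nonzero and drops out of the character quotient. For R,
  the product form of z / h(z) contains 1 + (p_1 + ... + p_m) z, whose linear coefficient has the
  wrong sign for the alternating pattern. Telescoping absorbs this factor: each step leaves a term
  divisible by q_j z, and q_j z has the right sign after q becomes -q.\<close>

definition monom_eval :: "(pq_var \<Rightarrow> 'a) \<Rightarrow> pq_monom \<Rightarrow> 'a::comm_ring_1" where
  "monom_eval x a = (\<Prod>v \<in> Poly_Mapping.keys a. x v ^ Poly_Mapping.lookup a v)"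

lemma monom_eval_superset:
  assumes "finite V" "Poly_Mapping.keys a \<subseteq> V"
  shows "monom_eval x a = (\<Prod>v \<in> V. x v ^ Poly_Mapping.lookup a v)"
  unfolding monom_eval_def using assms
  by (intro prod.mono_neutral_left) (auto simp: in_keys_iff)

lemma monom_eval_add: "monom_eval x (a + b) = monom_eval x a * monom_eval x b"
proof -
  let ?V = "Poly_Mapping.keys a \<union> Poly_Mapping.keys b"
  have "Poly_Mapping.keys (a + b) \<subseteq> ?V" by (rule keys_add)
  then show ?thesis
    by (simp add: monom_eval_superset[of ?V] lookup_add power_add prod.distrib)
qed

lemma poly_mapping_sum_single:
  "f = (\<Sum>a \<in> Poly_Mapping.keys f. Poly_Mapping.single a (Poly_Mapping.lookup f a))"
  by (rule poly_mapping_eqI)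
     (auto simp: lookup_sum lookup_single when_def in_keys_iff sum.delta)

lemma mult_sum_singles:
  fixes f g :: pq_poly
  shows "f * g = (\<Sum>a \<in> Poly_Mapping.keys f. \<Sum>b \<in> Poly_Mapping.keys g.
    Poly_Mapping.single a (Poly_Mapping.lookup f a) * Poly_Mapping.single b (Poly_Mapping.lookup g b))"
  by (simp flip: sum_product poly_mapping_sum_single)

definition rat_hom :: "(rat \<Rightarrow> 'a::comm_ring_1) \<Rightarrow> bool" where
  "rat_hom \<phi> \<longleftrightarrow> \<phi> 0 = 0 \<and> \<phi> 1 = 1 \<and> (\<forall>a b. \<phi> (a + b) = \<phi> a + \<phi> b) \<and> (\<forall>a b. \<phi> (a * b) = \<phi> a * \<phi> b)"

lemma poly_eval_superset:
  assumes "rat_hom \<phi>" "finite A" "Poly_Mapping.keys f \<subseteq> A"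
  shows "poly_eval \<phi> x f = (\<Sum>a \<in> A. \<phi> (Poly_Mapping.lookup f a) * monom_eval x a)"
  unfolding poly_eval_def monom_eval_def[symmetric] using assms
  by (intro sum.mono_neutral_left) (auto simp: in_keys_iff rat_hom_def)

lemma poly_eval_add:
  assumes "rat_hom \<phi>"
  shows "poly_eval \<phi> x (f + g) = poly_eval \<phi> x f + poly_eval \<phi> x g"
proof -
  let ?V = "Poly_Mapping.keys f \<union> Poly_Mapping.keys g"
  have "Poly_Mapping.keys (f + g) \<subseteq> ?V" by (rule keys_add)
  then show ?thesis using assms
    by (simp add: poly_eval_superset[of \<phi> ?V] lookup_add sum.distrib rat_hom_def distrib_right)
qed

lemma poly_eval_single:
  assumes "rat_hom \<phi>"
  shows "poly_eval \<phi> x (Poly_Mapping.single a c) = \<phi> c * monom_eval x a"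
  using poly_eval_superset[OF assms, of "{a}"] by (auto simp: lookup_single)

lemma poly_eval_0: "poly_eval \<phi> x 0 = 0"
  by (simp add: poly_eval_def)

lemma poly_eval_sum:
  assumes "rat_hom \<phi>"
  shows "poly_eval \<phi> x (\<Sum>i\<in>I. f i) = (\<Sum>i\<in>I. poly_eval \<phi> x (f i))"
  by (induction I rule: infinite_finite_induct) (auto simp: poly_eval_0 poly_eval_add[OF assms])

lemma poly_eval_mult:
  assumes h: "rat_hom \<phi>"
  shows "poly_eval \<phi> x (f * g) = poly_eval \<phi> x f * poly_eval \<phi> x g"
proof -
  let ?s = "\<lambda>f a. Poly_Mapping.single a (Poly_Mapping.lookup f a)"
  have *: "poly_eval \<phi> x (?s f a * ?s g b) = poly_eval \<phi> x (?s f a) * poly_eval \<phi> x (?s g b)" for a b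
    using h by (simp add: mult_single poly_eval_single monom_eval_add rat_hom_def algebra_simps)
  have "f * g = (\<Sum>a\<in>Poly_Mapping.keys f. \<Sum>b\<in>Poly_Mapping.keys g. ?s f a * ?s g b)"
    by (rule mult_sum_singles)
  then have "poly_eval \<phi> x (f * g) =
      (\<Sum>a\<in>Poly_Mapping.keys f. poly_eval \<phi> x (?s f a)) * (\<Sum>b\<in>Poly_Mapping.keys g. poly_eval \<phi> x (?s g b))"
    by (simp add: poly_eval_sum[OF h] * sum_product)
  then show ?thesis
    by (simp flip: poly_eval_sum[OF h] poly_mapping_sum_single)
qed

lemma poly_eval_1:
  assumes "rat_hom \<phi>"
  shows "poly_eval \<phi> x 1 = 1"
proof -
  have "poly_eval \<phi> x (Poly_Mapping.single 0 1) = 1"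
    using assms by (simp only: poly_eval_single) (simp add: rat_hom_def monom_eval_def)
  then show ?thesis by simp
qed

lemma poly_eval_prod:
  assumes "rat_hom \<phi>"
  shows "poly_eval \<phi> x (\<Prod>i\<in>I. f i) = (\<Prod>i\<in>I. poly_eval \<phi> x (f i))"
  by (induction I rule: infinite_finite_induct)
     (auto simp: poly_eval_1[OF assms] poly_eval_mult[OF assms])

lemma poly_eval_uminus:
  assumes "rat_hom \<phi>"
  shows "poly_eval \<phi> x (- f) = - poly_eval \<phi> x f"
  using poly_eval_add[OF assms, of x f "- f"] by (simp add: poly_eval_0 eq_neg_iff_add_eq_0 add.commute)

lemma poly_eval_Var:
  assumes "rat_hom \<phi>"
  shows "poly_eval \<phi> x (Var v) = x v"
  using assms by (simp add: Var_def poly_eval_single) (simp add: monom_eval_def rat_hom_def)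

lemma rat_hom_Const: "rat_hom Const"
  by (simp add: rat_hom_def Const_def single_add mult_single)

lemma rat_hom_id: "rat_hom id"
  by (simp add: rat_hom_def)

lemma neg_q_ring_hom:
  "neg_q 0 = 0" "neg_q 1 = 1" "neg_q (f + g) = neg_q f + neg_q g" "neg_q (f * g) = neg_q f * neg_q g"
  "neg_q (- f) = - neg_q f"
  by (simp_all add: neg_q_def poly_eval_0 poly_eval_1 poly_eval_add poly_eval_mult poly_eval_uminus rat_hom_Const)

lemma neg_q_sum: "neg_q (\<Sum>i\<in>I. f i) = (\<Sum>i\<in>I. neg_q (f i))"
  and neg_q_prod: "neg_q (\<Prod>i\<in>I. f i) = (\<Prod>i\<in>I. neg_q (f i))"
  by (simp_all add: neg_q_def poly_eval_sum poly_eval_prod rat_hom_Const)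

lemma neg_q_power: "neg_q (f ^ n) = neg_q f ^ n"
  by (induction n) (simp_all add: neg_q_ring_hom)

lemma neg_q_Var: "neg_q (p_ind i) = p_ind i" "neg_q (q_ind i) = - q_ind i"
  by (simp_all add: neg_q_def poly_eval_Var rat_hom_Const)

section \<open>Positivity of coefficients under sums and products\<close>

lemma pq_positive_iff: "pq_positive f \<longleftrightarrow> (\<forall>a. Poly_Mapping.lookup f a \<ge> 0)"
  unfolding pq_positive_def by (metis in_keys_iff order_le_less order_refl)

lemma pq_positive_0: "pq_positive 0"
  by (simp add: pq_positive_def)

lemma pq_positive_single: "c \<ge> 0 \<Longrightarrow> pq_positive (Poly_Mapping.single a c)"
  by (simp add: pq_positive_iff lookup_single when_def)

lemma pq_positive_1: "pq_positive 1"
  using pq_positive_single[of 1 0] by simp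

lemma pq_positive_Var: "pq_positive (Var v)"
  by (simp add: Var_def pq_positive_single)

lemma pq_positive_add: "pq_positive f \<Longrightarrow> pq_positive g \<Longrightarrow> pq_positive (f + g)"
  by (simp add: pq_positive_iff lookup_add)

lemma pq_positive_sum: "(\<And>i. i \<in> I \<Longrightarrow> pq_positive (f i)) \<Longrightarrow> pq_positive (\<Sum>i\<in>I. f i)"
  by (induction I rule: infinite_finite_induct) (auto simp: pq_positive_0 pq_positive_add)

lemma pq_positive_mult:
  assumes "pq_positive f" "pq_positive g"
  shows "pq_positive (f * g)"
  unfolding mult_sum_singles[of f g] using assms
  by (intro pq_positive_sum) (simp add: mult_single pq_positive_single pq_positive_iff[of f] pq_positive_iff[of g])

lemma pq_positive_prod: "(\<And>i. i \<in> I \<Longrightarrow> pq_positive (f i)) \<Longrightarrow> pq_positive (\<Prod>i\<in>I. f i)"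
  by (induction I rule: infinite_finite_induct) (auto simp: pq_positive_1 pq_positive_mult)

lemma pq_positive_homogeneous_part: "pq_positive f \<Longrightarrow> pq_positive (homogeneous_part d f)"
  unfolding homogeneous_part_def
  by (intro pq_positive_sum pq_positive_single) (simp add: pq_positive_iff)

section \<open>Polynomials in the indeterminates of index 1 to m\<close>

lemma polys_in_add: "f \<in> polys_in m \<Longrightarrow> g \<in> polys_in m \<Longrightarrow> f + g \<in> polys_in m"
  using keys_add[of f g] unfolding polys_in_def by blast

lemma polys_in_mult:
  assumes "f \<in> polys_in m" "g \<in> polys_in m"
  shows "f * g \<in> polys_in m"
  unfolding polys_in_def
proof safe
  fix c v assume c: "c \<in> Poly_Mapping.keys (f * g)" "v \<in> Poly_Mapping.keys c"
  then obtain a b where "c = a + b" "a \<in> Poly_Mapping.keys f" "b \<in> Poly_Mapping.keys g"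
    using keys_mult[of f g] by blast
  then show "v \<in> pq_vars m"
    using c assms keys_add[of a b] unfolding polys_in_def by blast
qed

lemma polys_in_const: "Const c \<in> polys_in m"
  by (auto simp: polys_in_def Const_def)

lemma polys_in_0: "0 \<in> polys_in m" and polys_in_1: "1 \<in> polys_in m"
  using polys_in_const[of 0 m] polys_in_const[of 1 m] by (simp_all add: Const_def)

lemma polys_in_Var: "v \<in> pq_vars m \<Longrightarrow> Var v \<in> polys_in m"
  by (auto simp: polys_in_def Var_def)

lemma polys_in_sum: "(\<And>i. i \<in> I \<Longrightarrow> f i \<in> polys_in m) \<Longrightarrow> (\<Sum>i\<in>I. f i) \<in> polys_in m"
  by (induction I rule: infinite_finite_induct) (auto simp: polys_in_0 polys_in_add)

lemma polys_in_prod: "(\<And>i. i \<in> I \<Longrightarrow> f i \<in> polys_in m) \<Longrightarrow> (\<Prod>i\<in>I. f i) \<in> polys_in m"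
  by (induction I rule: infinite_finite_induct) (auto simp: polys_in_1 polys_in_mult)

lemma polys_in_uminus: "f \<in> polys_in m \<Longrightarrow> - f \<in> polys_in m"
  by (auto simp: polys_in_def keys_minus)

section \<open>Uniqueness of base-N digits and vanishing of polynomials\<close>

lemma digits_unique:
  fixes d d' :: "nat \<Rightarrow> nat"
  assumes "\<And>i. d i < N" "\<And>i. d' i < N"
    and "(\<Sum>i<L. d i * N ^ i) = (\<Sum>i<L. d' i * N ^ i)" "i < L"
  shows "d i = d' i"
  using assms
proof (induction L arbitrary: d d' i)
  case (Suc L)
  have *: "(\<Sum>i<Suc L. e i * N ^ i) = e 0 + N * (\<Sum>i<L. e (Suc i) * N ^ i)" for e :: "nat \<Rightarrow> nat"
    by (simp add: sum.lessThan_Suc_shift sum_distrib_left mult.left_commute del: sum.lessThan_Suc)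
  have eq: "d 0 + N * (\<Sum>i<L. d (Suc i) * N ^ i) = d' 0 + N * (\<Sum>i<L. d' (Suc i) * N ^ i)"
    using Suc.prems(3) by (simp only: *)
  have "d 0 = d' 0"
    using arg_cong[OF eq, of "\<lambda>x. x mod N"] Suc.prems(1,2) by simp
  moreover have "N > 0" using Suc.prems(1)[of 0] by simp
  ultimately have "(\<Sum>i<L. d (Suc i) * N ^ i) = (\<Sum>i<L. d' (Suc i) * N ^ i)"
    using eq by simp
  then have "d (Suc j) = d' (Suc j)" if "j < L" for j
    by (rule Suc.IH[of "\<lambda>i. d (Suc i)" "\<lambda>i. d' (Suc i)", OF Suc.prems(1,2) _ that])
  then show ?case using \<open>d 0 = d' 0\<close> \<open>i < Suc L\<close> by (cases i) auto
qed simp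

lemma digits_unique_indexed:
  fixes d d' :: "'a \<Rightarrow> nat" and idx :: "'a \<Rightarrow> nat"
  assumes V: "finite V" "inj_on idx V" and lt: "\<And>v. d v < N" "\<And>v. d' v < N"
    and eq: "(\<Sum>v\<in>V. d v * N ^ idx v) = (\<Sum>v\<in>V. d' v * N ^ idx v)" and "v \<in> V"
  shows "d v = d' v"
proof -
  obtain L where L: "idx ` V \<subseteq> {..<L}"
    using V finite_nat_bounded by blast
  define D where "D e i = (if i \<in> idx ` V then e (inv_into V idx i) else 0)" for e :: "'a \<Rightarrow> nat" and i
  have *: "(\<Sum>v\<in>V. e v * N ^ idx v) = (\<Sum>i<L. D e i * N ^ i)" for e
  proof -
    have "(\<Sum>i<L. D e i * N ^ i) = (\<Sum>i\<in>idx ` V. D e i * N ^ i)"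
      using L by (intro sum.mono_neutral_right) (auto simp: D_def)
    also have "\<dots> = (\<Sum>v\<in>V. e v * N ^ idx v)"
      using V by (simp add: sum.reindex D_def)
    finally show ?thesis by simp
  qed
  \<comment> \<open>Applied to \<open>v\<close>, the bound also yields \<open>0 < N\<close>, which
    is needed where \<open>D\<close> has its padding value 0.\<close>
  have "D e i < N" if "\<And>v. e v < N" for e i
    using that[of v] that by (auto simp: D_def)
  then have "D d (idx v) = D d' (idx v)"
    using lt eq L \<open>v \<in> V\<close> by (intro digits_unique[of "D d" N "D d'" L]) (auto simp: *)
  then show ?thesis using V \<open>v \<in> V\<close> by (simp add: D_def)
qed

text \<open>Kronecker substitution: powers of t with sparse exponents separate the
  monomials.\<close>

lemma polys_in_eq_0I:
  assumes f: "f \<in> polys_in m" and "m \<ge> 1"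
    and van: "\<And>p q. admissible m p q \<Longrightarrow> k \<le> (\<Sum>i = 1..m. p i * q i) \<Longrightarrow> poly_eval id (pq_point p q) f = 0"
  shows "f = 0"
proof -
  \<comment> \<open>Even positions for the p's, odd ones for the q's. The reversal
    \<open>m - i\<close> makes the substituted values of \<open>q i\<close> decrease strictly in
    \<open>i\<close>.\<close>
  define idx where "idx v = (case v of PVar i \<Rightarrow> 2 * i | QVar i \<Rightarrow> 2 * (m - i) + 1)" for v
  define S where "S = (\<Sum>a\<in>Poly_Mapping.keys f. \<Sum>v\<in>Poly_Mapping.keys a. Poly_Mapping.lookup a v)"
  \<comment> \<open>Every exponent in \<open>f\<close> is at most \<open>S\<close>, hence a digit to
    base \<open>N\<close>. The second \<open>Suc\<close> keeps \<open>N\<close> at least 2, so that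
    \<open>N ^ j\<close> increases strictly with \<open>j\<close>.\<close>
  define N where "N = Suc (Suc S)"
  define E where "E a = (\<Sum>v\<in>pq_vars m. Poly_Mapping.lookup a v * N ^ idx v)" for a
  have fin: "finite (pq_vars m)" by (simp add: pq_vars_def)
  have inj: "inj_on idx (pq_vars m)"
    unfolding inj_on_def pq_vars_def idx_def by (auto split: pq_var.splits) presburger+
  have lt: "Poly_Mapping.lookup a v < N" if "a \<in> Poly_Mapping.keys f" for a v
  proof (cases "v \<in> Poly_Mapping.keys a")
    case True
    have "Poly_Mapping.lookup a v \<le> (\<Sum>v\<in>Poly_Mapping.keys a. Poly_Mapping.lookup a v)"
      using True by (intro member_le_sum) auto
    also have "\<dots> \<le> S"
      unfolding S_def using that by (intro member_le_sum) auto
    finally show ?thesis by (simp add: N_def)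
  qed (simp add: in_keys_iff N_def)
  have E_inj: "inj_on E (Poly_Mapping.keys f)"
  proof (rule inj_onI)
    fix a b assume ab: "a \<in> Poly_Mapping.keys f" "b \<in> Poly_Mapping.keys f" "E a = E b"
    show "a = b"
    proof (rule poly_mapping_eqI)
      fix v
      show "Poly_Mapping.lookup a v = Poly_Mapping.lookup b v"
      proof (cases "v \<in> pq_vars m")
        case True
        then show ?thesis
          using digits_unique_indexed[OF fin inj, of "Poly_Mapping.lookup a" N "Poly_Mapping.lookup b" v] ab lt
          unfolding E_def by blast
      next
        case False
        then have "v \<notin> Poly_Mapping.keys a" "v \<notin> Poly_Mapping.keys b"
          using f ab unfolding polys_in_def by blast+
        then show ?thesis by (simp add: in_keys_iff)
      qed
    qed
  qed
  define Q where "Q = (\<Sum>a\<in>Poly_Mapping.keys f. Polynomial.monom (Poly_Mapping.lookup f a) (E a))"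
  \<comment> \<open>The bound gives \<open>t \<ge> 2\<close>, so that powers of \<open>t\<close>
    increase strictly, and \<open>t \<ge> k\<close>, so that the single summand
    \<open>p 1 * q 1 \<ge> t\<close> already makes the partition large enough.\<close>
  have root: "poly Q (of_nat t) = 0" if t: "t \<ge> k + 2" for t
  proof -
    define p where "p i = t ^ (N ^ (idx (PVar i)))" for i
    define q where "q i = t ^ (N ^ (idx (QVar i)))" for i
    have pt: "pq_point p q v = of_nat t ^ (N ^ idx v)" for v
      by (cases v) (simp_all add: pq_point_def p_def q_def)
    have adm: "admissible m p q"
      unfolding admissible_def
    proof (intro conjI ballI impI)
      fix i j assume "i \<in> {1..m}" "j \<in> {1..m}" "i < j"
      then have "N ^ idx (QVar j) < N ^ idx (QVar i)"
        by (intro power_strict_increasing) (auto simp: idx_def N_def)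
      then show "q j < q i"
        unfolding q_def using t by (intro power_strict_increasing[of "N ^ idx (QVar j)"]) auto
    qed (use t in \<open>auto simp: p_def q_def\<close>)
    have "p 1 * q 1 \<le> (\<Sum>i=1..m. p i * q i)"
      using \<open>m \<ge> 1\<close> by (intro member_le_sum) auto
    moreover have "t \<le> p 1" unfolding p_def using t
      by (intro self_le_power) (auto simp: N_def)
    moreover have "q 1 \<ge> 1" unfolding q_def using t by auto
    ultimately have "k \<le> (\<Sum>i=1..m. p i * q i)"
      using t mult_le_mono[of t "p 1" 1 "q 1"] by linarith
    then have "poly_eval id (pq_point p q) f = 0" using van adm by blast
    moreover have "monom_eval (pq_point p q) a = of_nat t ^ E a" if "a \<in> Poly_Mapping.keys f" for a
    proof -
      have "Poly_Mapping.keys a \<subseteq> pq_vars m" using f that by (auto simp: polys_in_def)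
      then have "monom_eval (pq_point p q) a = (\<Prod>v\<in>pq_vars m. pq_point p q v ^ Poly_Mapping.lookup a v)"
        by (rule monom_eval_superset[OF fin])
      also have "\<dots> = (\<Prod>v\<in>pq_vars m. of_nat t ^ (Poly_Mapping.lookup a v * N ^ idx v))"
        by (simp add: pt mult.commute flip: power_mult)
      also have "\<dots> = of_nat t ^ E a"
        by (simp add: E_def power_sum)
      finally show ?thesis .
    qed
    ultimately show ?thesis
      by (simp add: Q_def poly_sum poly_monom poly_eval_superset[OF rat_hom_id finite_keys order_refl])
  qed
  have "Q = 0"
  proof (rule ccontr)
    assume "Q \<noteq> 0"
    then have "finite {x. poly Q x = 0}" by (rule poly_roots_finite)
    moreover have "of_nat ` {k+2..} \<subseteq> {x. poly Q x = 0}" using root by auto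
    ultimately have "finite ((of_nat :: nat \<Rightarrow> rat) ` {k+2..})" by (rule rev_finite_subset)
    then show False
      using finite_imageD[of "of_nat :: nat \<Rightarrow> rat" "{k+2..}"] infinite_Ici[of "k+2"] by (auto simp: inj_on_def)
  qed
  show ?thesis
  proof (rule ccontr)
    assume "f \<noteq> 0"
    then obtain a where a: "a \<in> Poly_Mapping.keys f" by (metis keys_eq_empty all_not_in_conv)
    have "coeff Q (E a) = (\<Sum>b\<in>Poly_Mapping.keys f. if b = a then Poly_Mapping.lookup f b else 0)"
      unfolding Q_def coeff_sum using E_inj a
      by (intro sum.cong) (auto simp: inj_on_def)
    also have "\<dots> = Poly_Mapping.lookup f a" using a by (simp add: sum.delta')
    finally show False using a \<open>Q = 0\<close> by (simp add: in_keys_iff)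
  qed
qed

unbundle fps_syntax

section \<open>Power series and the polynomials R\<close>

text \<open>Only needed to make the polynomial ring an integral domain, through the type class instances
  of \<^theory>\<open>HOL-Library.Poly_Mapping\<close>.\<close>

instantiation pq_var :: linorder
begin

definition pq_var_code :: "pq_var \<Rightarrow> nat" where
  "pq_var_code v = (case v of PVar i \<Rightarrow> 2 * i | QVar i \<Rightarrow> 2 * i + 1)"

definition less_eq_pq_var :: "pq_var \<Rightarrow> pq_var \<Rightarrow> bool" where
  "v \<le> w \<longleftrightarrow> pq_var_code v \<le> pq_var_code w"

definition less_pq_var :: "pq_var \<Rightarrow> pq_var \<Rightarrow> bool" where
  "v < w \<longleftrightarrow> pq_var_code v < pq_var_code w"

instance
proof
  fix v w :: pq_var
  assume "v \<le> w" "w \<le> v"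
  then have "pq_var_code v = pq_var_code w" by (simp add: less_eq_pq_var_def)
  then show "v = w"
    by (cases v; cases w) (auto simp: pq_var_code_def, presburger+)
qed (auto simp: less_eq_pq_var_def less_pq_var_def)

end

section \<open>Lagrange's equation and compositional inverses\<close>

lemma fps_power_nth_cong:
  fixes f g :: "'a::comm_ring_1 fps"
  assumes "\<And>j. j \<le> n \<Longrightarrow> f $ j = g $ j"
  shows "(f ^ i) $ n = (g ^ i) $ n"
proof -
  have "(f ^ i) $ j = (g ^ i) $ j" if "j \<le> n" for j
    using that
  proof (induction i arbitrary: j)
    case (Suc i)
    then show ?case using assms
      by (auto simp: fps_mult_nth intro!: sum.cong)
  qed simp
  then show ?thesis by blast
qed

text \<open>Coefficients of the solution of g = X F(g). Coefficient n of F(g) involves only the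
  coefficients of g up to n; cutting the series off there makes the recursion terminate.\<close>

fun lagrange_coeff :: "'a::comm_ring_1 fps \<Rightarrow> nat \<Rightarrow> 'a" where
  "lagrange_coeff F 0 = 0"
| "lagrange_coeff F (Suc n) = (F oo Abs_fps (\<lambda>j. if j \<le> n then lagrange_coeff F j else 0)) $ n"

lemma lagrange_equation_solvable:
  fixes F :: "'a::comm_ring_1 fps"
  obtains g where "g = fps_X * (F oo g)"
proof
  let ?g = "Abs_fps (lagrange_coeff F)"
  show "?g = fps_X * (F oo ?g)"
  proof (rule fps_ext)
    fix n
    show "?g $ n = (fps_X * (F oo ?g)) $ n"
    proof (cases n)
      case (Suc l)
      have "(Abs_fps (\<lambda>j. if j \<le> l then lagrange_coeff F j else 0) ^ i) $ l = (?g ^ i) $ l" for i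
        by (rule fps_power_nth_cong) simp
      then show ?thesis using Suc by (simp add: fps_compose_nth)
    qed simp
  qed
qed

text \<open>Here \<open>fps_X * U\<close> is X / F(X). Substituting g gives g / F(g), which is X by
  the equation for g.\<close>

lemma lagrange_right_inverse:
  fixes F U g :: "'a::idom fps"
  assumes "F * U = 1" "g = fps_X * (F oo g)"
  shows "(fps_X * U) oo g = fps_X"
proof -
  have g0: "g $ 0 = 0" by (subst assms(2)) simp
  have "(fps_X * U) oo g = g * (U oo g)"
    by (simp add: fps_compose_mult_distrib[OF g0] g0)
  also have "\<dots> = fps_X * ((F oo g) * (U oo g))"
    by (subst (1) assms(2)) (simp add: mult.assoc)
  also have "\<dots> = fps_X"
    by (simp add: assms(1) flip: fps_compose_mult_distrib[OF g0])
  finally show ?thesis .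
qed

text \<open>\<open>fps_comp_inverse\<close> demands a two-sided inverse, while the equation yields
  one side only. The other side follows as in a monoid: g has the left inverse
  \<open>fps_X * U\<close>, so any right inverse of g agrees with it.\<close>

lemma fps_comp_inverse_eqI:
  fixes F U g :: "'a::idom fps"
  assumes FU: "F * U = 1" and g: "g = fps_X * (F oo g)"
  shows "fps_comp_inverse (fps_X * U) = g"
proof -
  have g0: "g $ 0 = 0" by (subst g) simp
  let ?h = "fps_X * U"
  have hg: "?h oo g = fps_X" by (rule lagrange_right_inverse[OF FU g])
  \<comment> \<open>Since g = X F(g) and F(g) is the reciprocal of U(g), the preceding lemma applies
    to g itself, with U(g) in the role of F, and supplies a right inverse of g.\<close>
  obtain h' where h': "h' = fps_X * ((U oo g) oo h')" by (rule lagrange_equation_solvable)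
  have h'0: "h' $ 0 = 0" by (subst h') simp
  have "(U oo g) * (F oo g) = 1"
    using FU by (simp add: mult.commute flip: fps_compose_mult_distrib[OF g0])
  from lagrange_right_inverse[OF this h'] have gh': "g oo h' = fps_X"
    by (simp flip: g)
  have "g oo ?h = (g oo ?h) oo (g oo h')" by (simp add: gh')
  also have "\<dots> = (g oo (?h oo g)) oo h'"
    by (simp add: fps_compose_assoc g0 h'0)
  also have "\<dots> = fps_X" by (simp add: hg gh')
  finally have gh: "g oo ?h = fps_X" .
  show ?thesis
    unfolding fps_comp_inverse_def
  proof (rule the_equality)
    fix g' assume g': "g' $ 0 = 0 \<and> ?h oo g' = fps_X \<and> g' oo ?h = fps_X"
    then have "g' = (g oo ?h) oo g'" by (simp add: gh fps_X_fps_compose_startby0)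
    also have "\<dots> = g oo (?h oo g')" using g' by (intro fps_compose_assoc[symmetric]) auto
    finally show "g' = g" using g' by simp
  qed (use g0 hg gh in blast)
qed

lemma fps_quotient_eqI:
  fixes f g r :: "'a::idom fps"
  assumes "g \<noteq> 0" "r * g = f"
  shows "fps_quotient f g = r"
  unfolding fps_quotient_def using assms by (intro the_equality) auto

lemma fps_right_inverse_1:
  fixes f :: "'a::comm_ring_1 fps"
  assumes "f $ 0 = 1"
  shows "f * fps_right_inverse f 1 = 1"
  by (rule fps_right_inverse) (simp add: assms)

lemma fps_const_sum: "fps_const (\<Sum>i\<in>A. c i :: 'a::comm_ring_1) = (\<Sum>i\<in>A. fps_const (c i))"
  by (induction A rule: infinite_finite_induct) (auto simp flip: fps_const_add)

lemma fps_prod_nth_0: "(\<Prod>i\<in>A. f i :: 'a::comm_ring_1 fps) $ 0 = (\<Prod>i\<in>A. f i $ 0)"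
  by (induction A rule: infinite_finite_induct) auto

section \<open>The quotient z / h(z) in geometric series\<close>

definition geo :: "'a::comm_ring_1 \<Rightarrow> 'a fps" where
  "geo c = fps_right_inverse (1 - fps_const c * fps_X) 1"

lemma geo_mult: "(1 - fps_const c * fps_X) * geo c = 1"
  unfolding geo_def by (rule fps_right_inverse_1) simp

text \<open>\<open>z / h(z) = 1 + z \<Phi>(z)\<close>, with denominators expanded as geometric series.\<close>

definition Phi :: "(nat \<Rightarrow> 'a::comm_ring_1) \<Rightarrow> (nat \<Rightarrow> 'a) \<Rightarrow> nat \<Rightarrow> 'a fps" where
  "Phi p q m = (\<Sum>j = 1..m. - (fps_const (p j) * (fps_const (q j) * fps_X)) * geo (q j - (\<Sum>i = 1..j. p i)) *
     (\<Prod>i = 1..<j. 1 - fps_const (p i) * fps_X * geo (q i - (\<Sum>l = 1..i. p l))))"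

text \<open>Writing 1 as (1 - (q - (P + p)) X) I turns 1 - (1 + (P + p) X) I into -q X I: all
  contributions of the p's cancel.\<close>

lemma telescoping_step:
  fixes p q P X I M :: "'a::comm_ring_1"
  assumes "(1 - (q - (P + p)) * X) * I = 1"
  shows "(1 + (P + p) * X) * (M * (1 - p * X * I)) = (1 + P * X) * M + X * (- (p * (q * X)) * I * M)"
proof -
  have "(1 + (P + p) * X) * (M * (1 - p * X * I)) = (1 + P * X) * M + M * p * X * (1 - (1 + (P + p) * X) * I)"
    by (simp add: algebra_simps)
  also have "1 - (1 + (P + p) * X) * I = (1 - (q - (P + p)) * X) * I - (1 + (P + p) * X) * I"
    by (simp only: assms)
  finally show ?thesis by (simp add: algebra_simps)
qed

text \<open>By \<open>prod_one_minus_geo\<close> the left-hand side is z / h(z) when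
  \<open>p\<close> and \<open>q\<close> are the indeterminates. Each induction step adds exactly one
  summand of \<open>Phi\<close>.\<close>

lemma one_plus_X_Phi:
  "(1 + fps_const (\<Sum>j = 1..m. p j) * fps_X) *
     (\<Prod>i = 1..m. 1 - fps_const (p i) * fps_X * geo (q i - (\<Sum>l = 1..i. p l))) = 1 + fps_X * Phi p q m"
proof (induction m)
  case 0
  then show ?case by (simp add: Phi_def)
next
  case (Suc m)
  let ?M = "\<Prod>i = 1..m. 1 - fps_const (p i) * fps_X * geo (q i - (\<Sum>l = 1..i. p l))"
  let ?P = "\<Sum>j = 1..m. p j"
  let ?I = "geo (q (Suc m) - (?P + p (Suc m)))"
  have "(1 - (fps_const (q (Suc m)) - (fps_const ?P + fps_const (p (Suc m)))) * fps_X) * ?I = 1"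
    using geo_mult[of "q (Suc m) - (?P + p (Suc m))"] by simp
  from telescoping_step[OF this, of ?M] Suc show ?case
    by (simp add: Phi_def atLeastLessThanSuc_atLeastAtMost algebra_simps)
qed

text \<open>Factor by factor, with c = q_i - (p_1 + ... + p_i): 1 - p_i X / (1 - c X) = (1 - (c +
  p_i) X) / (1 - c X), and c + p_i is the difference with p_i omitted from the sum.\<close>

lemma prod_one_minus_geo:
  fixes p q :: "nat \<Rightarrow> 'a::comm_ring_1"
  shows "(\<Prod>i = 1..m. 1 - fps_const (p i) * fps_X * geo (q i - (\<Sum>l = 1..i. p l))) *
     (\<Prod>i = 1..m. 1 - fps_const (q i - (\<Sum>j = 1..i. p j)) * fps_X) =
   (\<Prod>i = 1..m. 1 - fps_const (q i - (\<Sum>j = 1..<i. p j)) * fps_X)"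
  unfolding prod.distrib[symmetric]
proof (rule prod.cong[OF refl])
  fix i assume "i \<in> {1..m}"
  then have "{1..i} = insert i {1..<i}" by auto
  then have "(\<Sum>j = 1..i. p j) = (\<Sum>j = 1..<i. p j) + p i"
    by (simp add: add.commute)
  moreover define c where "c = q i - (\<Sum>j = 1..i. p j)"
  ultimately have c: "q i - (\<Sum>j = 1..<i. p j) = c + p i" by simp
  have "(1 - fps_const (p i) * fps_X * geo c) * (1 - fps_const c * fps_X) =
      (1 - fps_const c * fps_X) - fps_const (p i) * fps_X * ((1 - fps_const c * fps_X) * geo c)"
    by (simp add: algebra_simps del: fps_const_mult)
  also have "\<dots> = 1 - fps_const (c + p i) * fps_X"
    by (simp only: geo_mult) (simp add: algebra_simps flip: fps_const_add)
  finally show "(1 - fps_const (p i) * fps_X * geo (q i - (\<Sum>l = 1..i. p l))) * (1 - fps_const (q i - (\<Sum>j = 1..i. p j)) * fps_X) =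
      1 - fps_const (q i - (\<Sum>j = 1..<i. p j)) * fps_X"
    unfolding c by (simp only: c_def)
qed

lemma R_series_eq:
  obtains g where "g = fps_X * ((1 + fps_X * Phi p_ind q_ind m) oo g)"
    and "R_series m = 1 - fps_X * (Phi p_ind q_ind m oo g)"
proof -
  define F where "F = 1 + fps_X * Phi p_ind q_ind m"
  obtain g where g: "g = fps_X * (F oo g)" by (rule lagrange_equation_solvable)
  have g0: "g $ 0 = 0" by (subst g) simp
  define num where "num = (\<Prod>i = 1..m. 1 - fps_const (q_ind i - (\<Sum>j = 1..i. p_ind j)) * fps_X)"
  define den where "den = (1 + (\<Sum>j = 1..m. fps_const (p_ind j) * fps_X)) *
      (\<Prod>i = 1..m. 1 - fps_const (q_ind i - (\<Sum>j = 1..<i. p_ind j)) * fps_X)"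
  have "F * num = den"
    unfolding F_def num_def den_def one_plus_X_Phi[symmetric]
      mult.assoc[of "1 + fps_const (\<Sum>j = 1..m. p_ind j) * fps_X"] prod_one_minus_geo
    by (simp only: sum_distrib_right fps_const_sum)
  have n0: "num $ 0 = 1" and d0: "den $ 0 = 1"
    by (simp_all add: num_def den_def fps_prod_nth_0 fps_sum_nth)
  then have nz: "num \<noteq> 0" "den \<noteq> 0" by auto
  \<comment> \<open>\<open>U\<close> is num / den, that is h(z) / z; \<open>F\<close> is its
    reciprocal.\<close>
  define U where "U = num * fps_right_inverse den 1"
  have dU: "den * U = num"
    using fps_right_inverse_1[OF d0] by (simp add: U_def mult.left_commute)
  have "(F * U) * num = (F * num) * U" by (simp add: mult.assoc mult.commute)
  then have "(F * U) * num = num" by (simp only: \<open>F * num = den\<close> dU)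
  then have FU: "F * U = 1" using nz by simp
  have "h_series m = fps_X * U"
    unfolding h_series_def num_def[symmetric] den_def[symmetric]
    using nz dU by (intro fps_quotient_eqI) (simp_all add: mult.assoc mult.commute[of U])
  then have inv: "fps_comp_inverse (h_series m) = g"
    by (simp only: fps_comp_inverse_eqI[OF FU g])
  have "F oo g = 1 + g * (Phi p_ind q_ind m oo g)"
    by (simp add: F_def fps_compose_add_distrib fps_compose_mult_distrib[OF g0] g0)
  moreover note g
  ultimately have g': "g = fps_X * (1 + g * (Phi p_ind q_ind m oo g))" by (simp only:)
  have "(1 - fps_X * (Phi p_ind q_ind m oo g)) * g = g - fps_X * (g * (Phi p_ind q_ind m oo g))"
    by (simp only: left_diff_distrib mult_1_left mult.assoc mult.commute[of g])
  also have "\<dots> = fps_X * (1 + g * (Phi p_ind q_ind m oo g)) - fps_X * (g * (Phi p_ind q_ind m oo g))"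
    by (simp only: g'[symmetric])
  also have "\<dots> = fps_X" by (simp add: distrib_left)
  finally have *: "(1 - fps_X * (Phi p_ind q_ind m oo g)) * g = fps_X" .
  then have "g \<noteq> 0" by auto
  with * have "R_series m = 1 - fps_X * (Phi p_ind q_ind m oo g)"
    unfolding R_series_def inv by (intro fps_quotient_eqI)
  then show thesis using that[OF g[unfolded F_def]] by blast
qed

text \<open>With \<open>P\<close> the polynomials \<open>f\<close> such that \<^term>\<open>neg_q f\<close> is positive, the substitution of
  \<open>- q\<close> for \<open>q\<close> never has to be applied to a power series.\<close>

locale positive_cone =
  fixes P :: "'a::comm_ring_1 set"
  assumes zero: "0 \<in> P" and one: "1 \<in> P"
    and add: "a \<in> P \<Longrightarrow> b \<in> P \<Longrightarrow> a + b \<in> P"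
    and mult: "a \<in> P \<Longrightarrow> b \<in> P \<Longrightarrow> a * b \<in> P"
begin

text \<open>Equivalently, f(-X) has all coefficients in \<open>P\<close>.\<close>

definition alternating :: "'a fps \<Rightarrow> bool" where
  "alternating f \<longleftrightarrow> (\<forall>n. (-1) ^ n * f $ n \<in> P)"

lemma alternatingD: "alternating f \<Longrightarrow> (-1) ^ n * f $ n \<in> P"
  by (simp add: alternating_def)

lemma sum: "(\<And>i. i \<in> A \<Longrightarrow> f i \<in> P) \<Longrightarrow> (\<Sum>i\<in>A. f i) \<in> P"
  by (induction A rule: infinite_finite_induct) (auto simp: zero add)

lemma alternating_0: "alternating 0" and alternating_1: "alternating 1"
  by (auto simp: alternating_def zero one fps_one_nth)

lemma alternating_add: "alternating f \<Longrightarrow> alternating g \<Longrightarrow> alternating (f + g)"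
  by (simp add: alternating_def distrib_left add)

lemma alternating_mult:
  assumes "alternating f" "alternating g"
  shows "alternating (f * g)"
  unfolding alternating_def
proof
  fix n
  have "(-1) ^ n * (f * g) $ n = (\<Sum>i = 0..n. ((-1) ^ i * f $ i) * ((-1) ^ (n - i) * g $ (n - i)))"
    unfolding fps_mult_nth sum_distrib_left
  proof (rule sum.cong[OF refl])
    fix i assume "i \<in> {0..n}"
    then have "(-1 :: 'a) ^ n = (-1) ^ i * (-1) ^ (n - i)" by (simp flip: power_add)
    then show "(-1) ^ n * (f $ i * g $ (n - i)) = ((-1) ^ i * f $ i) * ((-1) ^ (n - i) * g $ (n - i))"
      by (simp add: algebra_simps)
  qed
  also have "\<dots> \<in> P" using assms by (intro sum mult alternatingD)
  finally show "(-1) ^ n * (f * g) $ n \<in> P" .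
qed

lemma alternating_power: "alternating f \<Longrightarrow> alternating (f ^ n)"
  by (induction n) (auto simp: alternating_1 alternating_mult)

lemma alternating_sum: "(\<And>i. i \<in> A \<Longrightarrow> alternating (f i)) \<Longrightarrow> alternating (\<Sum>i\<in>A. f i)"
  by (induction A rule: infinite_finite_induct) (auto simp: alternating_0 alternating_add)

lemma alternating_prod: "(\<And>i. i \<in> A \<Longrightarrow> alternating (f i)) \<Longrightarrow> alternating (\<Prod>i\<in>A. f i)"
  by (induction A rule: infinite_finite_induct) (auto simp: alternating_1 alternating_mult)

lemma alternating_const: "c \<in> P \<Longrightarrow> alternating (fps_const c)"
  by (auto simp: alternating_def zero fps_nth_fps_const)

lemma alternating_minus_X: "alternating (- fps_X)"
  by (auto simp: alternating_def zero one fps_X_nth)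

lemma alternating_linear: "- c \<in> P \<Longrightarrow> alternating (fps_const c * fps_X)"
  using alternating_mult[OF alternating_const[of "- c"] alternating_minus_X]
  by (simp flip: fps_const_neg)

lemma alternating_geo:
  assumes "- c \<in> P"
  shows "alternating (geo c)"
proof -
  have rec: "geo c = 1 + fps_const c * (fps_X * geo c)"
    using geo_mult[of c] by (simp add: algebra_simps)
  have "(-1) ^ n * geo c $ n \<in> P" for n
  proof (induction n)
    case 0
    show ?case by (subst rec) (simp add: one)
  next
    case (Suc n)
    have "geo c $ Suc n = c * geo c $ n" by (subst rec) simp
    then have "(-1) ^ Suc n * geo c $ Suc n = - c * ((-1) ^ n * geo c $ n)"
      by (simp add: algebra_simps)
    then show ?case using mult[OF assms Suc] by simp
  qed
  then show ?thesis by (simp add: alternating_def)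
qed

text \<open>The sign (-1)^i is shared between the coefficient f_i and the i-th power of g, which
  becomes a power of -g. Hence the pattern is required of -g rather than g.\<close>

lemma alternating_compose:
  assumes "alternating f" "alternating (- g)"
  shows "alternating (f oo g)"
  unfolding alternating_def
proof
  fix n
  have "(-1) ^ n * (f oo g) $ n = (\<Sum>i = 0..n. ((-1) ^ i * f $ i) * ((-1) ^ n * ((- g) ^ i) $ n))"
    unfolding fps_compose_nth sum_distrib_left
  proof (rule sum.cong[OF refl])
    fix i
    have "(- g) ^ i = fps_const ((-1) ^ i) * g ^ i"
      by (simp add: power_minus[of g] flip: fps_const_power fps_const_neg)
    then have "((- g) ^ i) $ n = (-1) ^ i * (g ^ i) $ n"
      by simp
    then show "(-1) ^ n * (f $ i * (g ^ i) $ n) = ((-1) ^ i * f $ i) * ((-1) ^ n * ((- g) ^ i) $ n)"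
      by (simp add: algebra_simps flip: power_add)
  qed
  also have "\<dots> \<in> P"
    using assms by (intro sum mult alternatingD alternating_power)
  finally show "(-1) ^ n * (f oo g) $ n \<in> P" .
qed

text \<open>Coefficient l + 1 of g is coefficient l of F(g); this shift by one accounts for the sign
  between -g and F(g), and allows strong induction.\<close>

lemma alternating_lagrange:
  assumes F: "alternating F" and g: "g = fps_X * (F oo g)"
  shows "alternating (- g)"
proof -
  have "(-1) ^ n * (- g) $ n \<in> P" for n
  proof (induction n rule: less_induct)
    case (less n)
    show ?case
    proof (cases n)
      case 0
      then show ?thesis by (subst g) (simp add: zero)
    next
      case (Suc l)
      \<comment> \<open>The induction hypothesis covers only the coefficients up to
        \<open>l\<close>. The truncation is an alternating series (up to sign) to which
        \<open>alternating_compose\<close> applies, and it has the same relevant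
        coefficients.\<close>
      define t where "t = Abs_fps (\<lambda>j. if j \<le> l then g $ j else 0)"
      have "(t ^ i) $ l = (g ^ i) $ l" for i
        by (rule fps_power_nth_cong) (simp add: t_def)
      then have "(F oo g) $ l = (F oo t) $ l" by (simp add: fps_compose_nth)
      moreover have "alternating (- t)"
        using less Suc zero by (auto simp: alternating_def t_def)
      then have "(-1) ^ l * (F oo t) $ l \<in> P"
        using alternating_compose[OF F] by (auto simp: alternating_def)
      moreover have "g $ n = (F oo g) $ l"
        by (subst g) (simp add: Suc)
      ultimately show ?thesis using Suc by simp
    qed
  qed
  then show ?thesis by (simp add: alternating_def)
qed

lemma alternating_minus_Phi:
  assumes p: "\<And>i. p i \<in> P" and q: "\<And>i. - q i \<in> P"
  shows "alternating (- Phi p q m)"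
proof -
  have c: "- (q i - (\<Sum>j = 1..i. p j)) \<in> P" for i
    using add[OF q[of i] sum[of "{1..i}" p]] p by simp
  have 1: "alternating (1 - fps_const (p i) * fps_X * geo (q i - (\<Sum>l = 1..i. p l)))" for i
    using alternating_add[OF alternating_1 alternating_mult[OF alternating_linear[of "- p i"] alternating_geo[OF c[of i]]]] p
    by (simp flip: fps_const_neg)
  have "- Phi p q m = (\<Sum>j = 1..m. fps_const (p j) * (fps_const (q j) * fps_X) * geo (q j - (\<Sum>i = 1..j. p i)) *
     (\<Prod>i = 1..<j. 1 - fps_const (p i) * fps_X * geo (q i - (\<Sum>l = 1..i. p l))))"
    by (simp add: Phi_def sum_negf)
  then show ?thesis
    by (simp only:) (intro alternating_sum alternating_mult alternating_prod 1 alternating_const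
        alternating_linear alternating_geo p q c)
qed

end

lemma R_poly_positive:
  "pq_positive ((-1) ^ k * neg_q (R_poly m (k + 1)))"
proof -
  interpret positive_cone "{f. pq_positive (neg_q f)}"
    by unfold_locales (auto simp: neg_q_ring_hom pq_positive_0 pq_positive_1 pq_positive_add pq_positive_mult)
  let ?Phi = "Phi p_ind q_ind m"
  obtain g where g: "g = fps_X * ((1 + fps_X * ?Phi) oo g)" and R: "R_series m = 1 - fps_X * (?Phi oo g)"
    by (rule R_series_eq)
  have Phi: "alternating (- ?Phi)"
    by (rule alternating_minus_Phi) (simp_all add: neg_q_Var neg_q_ring_hom pq_positive_Var)
  \<comment> \<open>X \<open>Phi\<close> is read as (-X)(-\<open>Phi\<close>), a product of two
    alternating series.\<close>
  have "alternating (1 + fps_X * ?Phi)"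
    using alternating_add[OF alternating_1 alternating_mult[OF alternating_minus_X Phi]] by simp
  then have "alternating (- g)"
    using g by (rule alternating_lagrange)
  then have "alternating (- ?Phi oo g)"
    by (rule alternating_compose[OF Phi])
  moreover have "R_poly m (k + 1) = (- ?Phi oo g) $ k"
    by (simp add: R_poly_def R fps_compose_uminus)
  ultimately show ?thesis
    by (simp add: alternating_def neg_q_ring_hom neg_q_power)
qed

section \<open>Counting functions invariant under a permutation\<close>

definition orbits_on :: "'a set \<Rightarrow> ('a \<Rightarrow> 'a) \<Rightarrow> 'a set set" where
  "orbits_on S \<sigma> = Orbits.orbit \<sigma> ` S"

definition invariant_on :: "'a set \<Rightarrow> ('a \<Rightarrow> 'a) \<Rightarrow> ('a \<Rightarrow> 'b) \<Rightarrow> bool" where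
  "invariant_on S \<sigma> g \<longleftrightarrow> (\<forall>x\<in>S. g (\<sigma> x) = g x)"

lemma finite_orbits_on: "finite S \<Longrightarrow> finite (orbits_on S \<sigma>)"
  by (simp add: orbits_on_def)

lemma orbits_on_subset: "\<sigma> permutes S \<Longrightarrow> Z \<in> orbits_on S \<sigma> \<Longrightarrow> Z \<subseteq> S"
  using permutes_orbit_subset by (fastforce simp: orbits_on_def)

lemma orbits_on_nonempty: "Z \<in> orbits_on S \<sigma> \<Longrightarrow> Z \<noteq> {}"
  by (auto simp: orbits_on_def intro: Orbits.orbit.base)

lemma invariant_on_orbit:
  assumes "\<sigma> permutes S" "x \<in> S" "invariant_on S \<sigma> g" "y \<in> Orbits.orbit \<sigma> x"
  shows "g y = g x"
proof -
  have sub: "Orbits.orbit \<sigma> x \<subseteq> S" by (rule permutes_orbit_subset) fact+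
  from assms(4) show ?thesis
    by induction (use assms sub in \<open>auto simp: invariant_on_def\<close>)
qed

lemma invariant_on_orbits_on:
  assumes "\<sigma> permutes S" "invariant_on S \<sigma> g" "Z \<in> orbits_on S \<sigma>" "x \<in> Z" "y \<in> Z"
  shows "g y = g x"
  using assms invariant_on_orbit[of \<sigma> S _ g] unfolding orbits_on_def by (metis imageE)

text \<open>An invariant function is a free choice of one value per orbit, and that value must be
  allowed at every point of the orbit: hence the intersection. \<open>D\<close> depends on the point
  because the available columns depend on the chosen row.\<close>

lemma card_invariant_functions:
  fixes S :: "'a set" and D :: "'a \<Rightarrow> 'b set"
  assumes S: "finite S" "\<sigma> permutes S"
  shows "card {g \<in> PiE S D. invariant_on S \<sigma> g} = (\<Prod>Z\<in>orbits_on S \<sigma>. card (\<Inter>x\<in>Z. D x))"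
proof -
  let ?orb = "Orbits.orbit \<sigma>"
  have perm: "permutation \<sigma>" using S permutation_permutes by blast
  have self: "x \<in> ?orb x" for x by (rule permutation_self_in_orbit[OF perm])
  have eq: "?orb y = ?orb x" if "y \<in> ?orb x" for x y
    by (rule orbit_cyclic_eq3[OF cyclic_on_orbit[OF S(2,1)] that])
  have step: "?orb (\<sigma> x) = ?orb x" for x by (rule permutation_orbit_step[OF perm])
  have sub: "?orb x \<subseteq> S" if "x \<in> S" for x by (rule permutes_orbit_subset[OF S(2) that])
  define F where "F h = (\<lambda>x\<in>S. h (?orb x))" for h :: "'a set \<Rightarrow> 'b"
  have "bij_betw F (PiE (orbits_on S \<sigma>) (\<lambda>Z. \<Inter>x\<in>Z. D x)) {g \<in> PiE S D. invariant_on S \<sigma> g}"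
  proof (rule bij_betw_imageI)
    show "inj_on F (PiE (orbits_on S \<sigma>) (\<lambda>Z. \<Inter>x\<in>Z. D x))"
    proof (rule inj_onI)
      fix h h' assume h: "h \<in> PiE (orbits_on S \<sigma>) (\<lambda>Z. \<Inter>x\<in>Z. D x)" "h' \<in> PiE (orbits_on S \<sigma>) (\<lambda>Z. \<Inter>x\<in>Z. D x)"
        and "F h = F h'"
      then have "h (?orb x) = h' (?orb x)" if "x \<in> S" for x
        using that by (auto simp: F_def dest!: fun_cong[of _ _ x])
      then show "h = h'" using h by (intro PiE_ext) (auto simp: orbits_on_def)
    qed
    show "F ` PiE (orbits_on S \<sigma>) (\<lambda>Z. \<Inter>x\<in>Z. D x) = {g \<in> PiE S D. invariant_on S \<sigma> g}"
    proof (intro equalityI subsetI)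
      fix g assume "g \<in> F ` PiE (orbits_on S \<sigma>) (\<lambda>Z. \<Inter>x\<in>Z. D x)"
      then obtain h where h: "h \<in> PiE (orbits_on S \<sigma>) (\<lambda>Z. \<Inter>x\<in>Z. D x)" "g = F h" by blast
      have "h (?orb x) \<in> D x" if "x \<in> S" for x
      proof -
        have "h (?orb x) \<in> (\<Inter>x\<in>?orb x. D x)" using h(1) that by (auto simp: orbits_on_def)
        then show ?thesis using self[of x] by blast
      qed
      then show "g \<in> {g \<in> PiE S D. invariant_on S \<sigma> g}"
        using h(2) by (auto simp: F_def invariant_on_def step permutes_in_image[OF S(2)])
    next
      fix g assume "g \<in> {g \<in> PiE S D. invariant_on S \<sigma> g}"
      then have g: "g \<in> PiE S D" "invariant_on S \<sigma> g" by auto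
      define h where "h = (\<lambda>Z\<in>orbits_on S \<sigma>. g (SOME x. x \<in> Z))"
      have h_orb: "h (?orb x) = g x" if "x \<in> S" for x
      proof -
        have "(SOME y. y \<in> ?orb x) \<in> ?orb x" using self by (rule someI)
        then show ?thesis
          using invariant_on_orbit[OF S(2) that g(2)] that by (simp add: h_def orbits_on_def)
      qed
      have "h \<in> PiE (orbits_on S \<sigma>) (\<lambda>Z. \<Inter>x\<in>Z. D x)"
      proof (rule PiE_I)
        fix Z assume "Z \<in> orbits_on S \<sigma>"
        then obtain x where x: "x \<in> S" "Z = ?orb x" by (auto simp: orbits_on_def)
        have "h Z \<in> D y" if "y \<in> Z" for y
        proof -
          have "y \<in> S" "Z = ?orb y" using that x sub eq by auto
          then show ?thesis using h_orb[of y] g(1) by auto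
        qed
        then show "h Z \<in> (\<Inter>x\<in>Z. D x)" by blast
      qed (simp add: h_def)
      moreover have "g = F h"
        using g(1) h_orb by (intro ext) (auto simp: F_def PiE_def extensional_def)
      ultimately show "g \<in> F ` PiE (orbits_on S \<sigma>) (\<lambda>Z. \<Inter>x\<in>Z. D x)" by blast
    qed
  qed
  from bij_betw_same_card[OF this] show ?thesis
    by (simp add: card_PiE finite_orbits_on S)
qed

lemma card_invariant_binary_functions:
  assumes "finite S" "\<sigma> permutes S"
  shows "card {g \<in> S \<rightarrow>\<^sub>E {..<2::nat}. invariant_on S \<sigma> g} = 2 ^ card (orbits_on S \<sigma>)"
proof -
  have "card (\<Inter>x\<in>Z. {..<2::nat}) = 2" if "Z \<in> orbits_on S \<sigma>" for Z
    using orbits_on_nonempty[OF that] by simp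
  then show ?thesis using card_invariant_functions[OF assms, of "\<lambda>_. {..<2::nat}"] by simp
qed

text \<open>Orbits are counted through the invariant functions into a two-element set: adjoining
  the new point a to the orbit of b does not change their number.\<close>

lemma sign_eq_orbits:
  assumes "finite S" "\<sigma> permutes S"
  shows "sign \<sigma> = (-1) ^ (card S + card (orbits_on S \<sigma>))"
  using assms
proof (induction S arbitrary: \<sigma> rule: finite_induct)
  case empty
  then show ?case by (simp add: orbits_on_def)
next
  case (insert a S)
  then obtain b q where \<sigma>: "\<sigma> = transpose a b \<circ> q" and b: "b \<in> insert a S" and q: "q permutes S"
  proof -
    have "\<sigma> \<in> (\<lambda>(b, p). transpose a b \<circ> p) ` {(b, p). b \<in> insert a S \<and> p \<in> {p. p permutes S}}"
      using insert.prems unfolding permutes_insert[symmetric] by simp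
    then show ?thesis using that by auto
  qed
  have IH: "sign q = (-1) ^ (card S + card (orbits_on S q))" by (rule insert.IH[OF q])
  show ?case
  proof (cases "b = a")
    case True
    then have "\<sigma> = q" using \<sigma> by simp
    moreover have "Orbits.orbit q a = {a}"
      using permutes_not_in[OF q insert(2)] by (simp add: orbit_eq_singleton_iff)
    moreover have "{a} \<notin> orbits_on S q"
      using orbits_on_subset[OF q] insert(2) by blast
    ultimately show ?thesis using IH insert(1,2) by (simp add: orbits_on_def)
  next
    case False
    then have "b \<in> S" using b by simp
    have \<sigma>a: "\<sigma> a = b" using permutes_not_in[OF q insert(2)] by (simp add: \<sigma>)
    have \<sigma>x: "\<sigma> x = (if q x = b then a else q x)" if "x \<in> S" for x
      using permutes_in_image[OF q, of x] that insert(2) by (auto simp: \<sigma> transpose_def)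
    let ?A = "{g \<in> insert a S \<rightarrow>\<^sub>E {..<2::nat}. invariant_on (insert a S) \<sigma> g}"
    let ?B = "{g \<in> S \<rightarrow>\<^sub>E {..<2::nat}. invariant_on S q g}"
    \<comment> \<open>Composing with the transposition inserts \<open>a\<close> into the cycle of
      \<open>b\<close>, immediately before \<open>b\<close>. An invariant function is thus
      determined by its restriction to \<open>S\<close>.\<close>
    have inv: "invariant_on (insert a S) \<sigma> g \<longleftrightarrow> g a = g b \<and> invariant_on S q g" for g :: "'a \<Rightarrow> nat"
      using \<sigma>a \<sigma>x by (auto simp: invariant_on_def)
    have cong: "invariant_on S q g \<longleftrightarrow> invariant_on S q g'" if "\<And>x. x \<in> S \<Longrightarrow> g x = g' x" for g g' :: "'a \<Rightarrow> nat"
      using that permutes_in_image[OF q] by (auto simp: invariant_on_def)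
    have "bij_betw (\<lambda>g. restrict g S) ?A ?B"
    proof (rule bij_betw_byWitness[where f' = "\<lambda>g. g(a := g b)"])
      show "\<forall>g\<in>?A. (restrict g S)(a := restrict g S b) = g"
        using \<open>b \<in> S\<close> by (auto simp: inv fun_eq_iff PiE_def extensional_def)
      show "\<forall>g\<in>?B. restrict (g(a := g b)) S = g"
        using insert(2) by (auto simp: fun_eq_iff PiE_def extensional_def)
      show "(\<lambda>g. restrict g S) ` ?A \<subseteq> ?B"
        using cong[of "restrict g S" g for g] by (auto simp: inv)
      show "(\<lambda>g. g(a := g b)) ` ?B \<subseteq> ?A"
      proof
        fix g' assume "g' \<in> (\<lambda>g. g(a := g b)) ` ?B"
        then obtain g where g: "g \<in> ?B" "g' = g(a := g b)" by blast
        moreover have "invariant_on S q g'" using g insert(2) by (subst cong[of g' g]) auto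
        ultimately show "g' \<in> ?A" using \<open>b \<in> S\<close> False
          by (auto simp: inv PiE_def extensional_def Pi_def)
      qed
    qed
    then have "card ?A = card ?B" by (rule bij_betw_same_card)
    moreover have "finite (insert a S)" using insert(1) by simp
    ultimately have "(2::nat) ^ card (orbits_on (insert a S) \<sigma>) = 2 ^ card (orbits_on S q)"
      using card_invariant_binary_functions[OF _ insert.prems] card_invariant_binary_functions[OF insert(1) q]
      by simp
    then have "card (orbits_on (insert a S) \<sigma>) = card (orbits_on S q)" by simp
    moreover have "sign \<sigma> = - sign q"
      unfolding \<sigma> using False permutes_imp_permutation[OF insert(1) q]
      by (simp add: sign_compose permutation_swap_id sign_swap_id)
    ultimately show ?thesis using IH insert(1,2) by simp
  qed
qed

text \<open>Exchange argument: as many elements of \<open>S\<close> lie outside the initial segment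
  as are missing from it; the former are at least \<open>card S\<close>, the latter smaller.
  Equality of the sums leaves nothing missing.\<close>

lemma sum_lessThan_card_le:
  fixes S :: "nat set"
  assumes "finite S"
  shows "(\<Sum>{..<card S}) \<le> \<Sum>S" and "(\<Sum>{..<card S}) = \<Sum>S \<Longrightarrow> S = {..<card S}"
proof -
  let ?s = "card S"
  let ?A = "S - {..<?s}" and ?B = "{..<?s} - S"
  have cardAB: "card ?A = card ?B"
  proof -
    have "card ?A + card (S \<inter> {..<?s}) = card S"
      using card_Diff_subset_Int[of S "{..<?s}"] card_mono[OF assms, of "S \<inter> {..<?s}"] by simp
    moreover have "card ?B + card (S \<inter> {..<?s}) = card {..<?s}"
      using card_Diff_subset_Int[of "{..<?s}" S] card_mono[of "{..<?s}" "S \<inter> {..<?s}"] by (simp add: Int_commute)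
    ultimately show ?thesis by simp
  qed
  have S: "\<Sum>S = \<Sum>?A + \<Sum>(S \<inter> {..<?s})"
    using sum.Int_Diff[of S "\<lambda>x. x" "{..<?s}"] assms by simp
  have T: "\<Sum>{..<?s} = \<Sum>?B + \<Sum>(S \<inter> {..<?s})"
    using sum.Int_Diff[of "{..<?s}" "\<lambda>x. x" S] by (simp add: Int_commute)
  have A: "card ?B * ?s \<le> \<Sum>?A"
    using sum_bounded_below[of ?A ?s "\<lambda>x. x"] unfolding cardAB by auto
  have B: "\<Sum>?B + card ?B \<le> card ?B * ?s"
  proof -
    have "\<Sum>?B + card ?B = (\<Sum>x\<in>?B. x + 1)" unfolding sum.distrib by simp
    also have "\<dots> \<le> (\<Sum>x\<in>?B. ?s)" by (rule sum_mono) auto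
    finally show ?thesis by simp
  qed
  show "(\<Sum>{..<?s}) \<le> \<Sum>S" using S T A B by linarith
  assume "(\<Sum>{..<?s}) = \<Sum>S"
  then have "card ?B = 0" using S T A B by linarith
  then have "{..<?s} \<subseteq> S" by simp
  then show "S = {..<?s}" using assms by (metis card_lessThan card_subset_eq)
qed

section \<open>Row and column groups of a numbered diagram\<close>

text \<open>Row and column groups depend only on the coordinates of the numbered cells, so the
  argument is kept free of lists; \<open>diagram_cells\<close> supplies the instance.\<close>

locale numbered_diagram =
  fixes n l :: nat and row col :: "nat \<Rightarrow> nat" and len :: "nat \<Rightarrow> nat"
  assumes cells: "bij_betw (\<lambda>j. (row j, col j)) {..<n} (SIGMA r:{..<l}. {..<len r})"
begin

definition R :: "(nat \<Rightarrow> nat) set" where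
  "R = {\<sigma>. \<sigma> permutes {..<n} \<and> (\<forall>j<n. row (\<sigma> j) = row j)}"

definition C :: "(nat \<Rightarrow> nat) set" where
  "C = {\<sigma>. \<sigma> permutes {..<n} \<and> (\<forall>j<n. col (\<sigma> j) = col j)}"

lemma cell_inj: "i < n \<Longrightarrow> j < n \<Longrightarrow> row i = row j \<Longrightarrow> col i = col j \<Longrightarrow> i = j"
  using bij_betw_imp_inj_on[OF cells] by (auto dest: inj_onD)

lemma row_lt: "j < n \<Longrightarrow> row j < l"
  using bij_betw_imp_surj_on[OF cells] by blast

lemma col_lt: "j < n \<Longrightarrow> col j < len (row j)"
  using bij_betw_imp_surj_on[OF cells] by blast

lemma cell_surj: "r < l \<Longrightarrow> c < len r \<Longrightarrow> \<exists>j<n. row j = r \<and> col j = c"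
proof -
  assume "r < l" "c < len r"
  then have "(r, c) \<in> (\<lambda>j. (row j, col j)) ` {..<n}"
    using bij_betw_imp_surj_on[OF cells] by auto
  then show ?thesis by auto
qed

lemma R_inv: "r \<in> R \<Longrightarrow> inv r \<in> R"
  unfolding R_def by (auto simp: permutes_inv)
     (metis lessThan_iff permutes_in_image permutes_inv permutes_inverses(1))

lemma C_inv: "c \<in> C \<Longrightarrow> inv c \<in> C"
  unfolding C_def by (auto simp: permutes_inv)
     (metis lessThan_iff permutes_in_image permutes_inv permutes_inverses(1))

lemma R_comp: "r \<in> R \<Longrightarrow> r' \<in> R \<Longrightarrow> r \<circ> r' \<in> R"
  unfolding R_def by (auto simp: permutes_compose) (metis lessThan_iff permutes_in_image)

lemma C_comp: "c \<in> C \<Longrightarrow> c' \<in> C \<Longrightarrow> c \<circ> c' \<in> C"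
  unfolding C_def by (auto simp: permutes_compose) (metis lessThan_iff permutes_in_image)

lemma R_transpose: "a < n \<Longrightarrow> b < n \<Longrightarrow> row a = row b \<Longrightarrow> transpose a b \<in> R"
  by (auto simp: R_def permutes_swap_id transpose_def)

lemma C_transpose: "a < n \<Longrightarrow> b < n \<Longrightarrow> col a = col b \<Longrightarrow> transpose a b \<in> C"
  by (auto simp: C_def permutes_swap_id transpose_def)

lemma finite_R: "finite R" and finite_C: "finite C"
  by (auto simp: R_def C_def intro: finite_subset[OF _ finite_permutations[of "{..<n}"]])

text \<open>A rearrangement of the columns that meets every cell position at most once has the row
  lengths of the diagram and the same total of the column indices, hence fills the
  diagram.\<close>

lemma rearranged_cells:
  assumes g: "g permutes {..<n}" and inj: "inj_on (\<lambda>j. (row j, col (g j))) {..<n}"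
  shows "(\<lambda>j. (row j, col (g j))) ` {..<n} = (SIGMA r:{..<l}. {..<len r})"
proof -
  define D where "D r = (\<lambda>j. col (g j)) ` {j \<in> {..<n}. row j = r}" for r
  have inj_r: "inj_on (\<lambda>j. col (g j)) {j \<in> {..<n}. row j = r}" for r
    using inj by (auto simp: inj_on_def)
  have inj_c: "inj_on col {j \<in> {..<n}. row j = r}" for r
    using cell_inj by (auto simp: inj_on_def)
  have col_r: "col ` {j \<in> {..<n}. row j = r} = {..<len r}" if "r < l" for r
    using col_lt cell_surj[OF that] by force
  have card_D: "card (D r) = len r" if "r < l" for r
    using card_image[OF inj_r[of r]] card_image[OF inj_c[of r]] col_r[OF that] by (simp add: D_def)
  have img: "row ` {..<n} \<subseteq> {..<l}" using row_lt by auto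
  have "(\<Sum>r<l. \<Sum>(D r)) = (\<Sum>r<l. \<Sum>j\<in>{j \<in> {..<n}. row j = r}. col (g j))"
    unfolding D_def sum.reindex[OF inj_r] by simp
  also have "\<dots> = (\<Sum>j<n. col (g j))"
    using img by (intro sum.group) auto
  also have "\<dots> = (\<Sum>j<n. col j)"
    using sum.permute[OF g, of col] by (simp add: comp_def)
  also have "\<dots> = (\<Sum>r<l. \<Sum>j\<in>{j \<in> {..<n}. row j = r}. col j)"
    using img by (intro sum.group[symmetric]) auto
  also have "\<dots> = (\<Sum>r<l. \<Sum>{..<len r})"
  proof (rule sum.cong[OF refl])
    fix r assume "r \<in> {..<l}"
    then show "(\<Sum>j\<in>{j \<in> {..<n}. row j = r}. col j) = \<Sum>{..<len r}"
      using sum.reindex[OF inj_c[of r], of "\<lambda>x. x"] col_r[of r] by simp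
  qed
  finally have total: "(\<Sum>r<l. \<Sum>{..<len r}) = (\<Sum>r<l. \<Sum>(D r))" by simp
  \<comment> \<open>Inequalities in all rows with equal totals are equalities in each row.\<close>
  have D: "D r = {..<len r}" if "r < l" for r
  proof -
    have fin: "finite (D r)" for r by (simp add: D_def)
    have le: "\<Sum>{..<len r} \<le> \<Sum>(D r)" if "r \<in> {..<l}" for r
      using sum_lessThan_card_le(1)[OF fin, of r] that by (simp only: card_D lessThan_iff)
    have "\<Sum>{..<len r} = \<Sum>(D r)"
      by (rule sum_mono_inv[OF total le]) (simp_all add: that)
    then show ?thesis
      using sum_lessThan_card_le(2)[OF fin, of r] card_D[OF that] by simp
  qed
  have "(\<lambda>j. (row j, col (g j))) ` {..<n} = (SIGMA r:{..<l}. D r)"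
    using row_lt by (auto simp: D_def)
  then show ?thesis using D by (auto simp: Sigma_def)
qed

text \<open>Give each point j the column of its preimage under \<rho>. If no row repeats a column,
  these positions fill the diagram, and rearranging within rows yields \<open>w\<close> in
  \<open>R\<close> with \<open>w \<circ> \<rho>\<close> in \<open>C\<close>. Otherwise two points of
  one row have preimages in one column, and the transposition of the two points is conjugate under
  \<rho> to a transposition in \<open>C\<close>. The second case will force coefficients at \<rho>
  to vanish.\<close>

lemma von_neumann_dichotomy:
  assumes \<rho>: "\<rho> permutes {..<n}"
  obtains (product) r c where "r \<in> R" "c \<in> C" "\<rho> = r \<circ> c"
  | (swap) t where "t \<in> R" "inv \<rho> \<circ> t \<circ> \<rho> \<in> C" "sign (inv \<rho> \<circ> t \<circ> \<rho>) = -1"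
proof (cases "inj_on (\<lambda>j. (row j, col (inv \<rho> j))) {..<n}")
  case True
  have inv: "inv \<rho> permutes {..<n}" by (rule permutes_inv[OF \<rho>])
  have "\<exists>i<n. row i = row j \<and> col i = col (inv \<rho> j)" if "j < n" for j
  proof -
    have "(row j, col (inv \<rho> j)) \<in> (SIGMA r:{..<l}. {..<len r})"
      using rearranged_cells[OF inv True] that by blast
    then show ?thesis using cell_surj by auto
  qed
  then obtain w0 where w0: "\<And>j. j < n \<Longrightarrow> w0 j < n \<and> row (w0 j) = row j \<and> col (w0 j) = col (inv \<rho> j)"
    by metis
  define w where "w j = (if j < n then w0 j else j)" for j
  have w: "w j < n" "row (w j) = row j" "col (w j) = col (inv \<rho> j)" if "j < n" for j
    using w0[OF that] that by (simp_all add: w_def)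
  have "inj_on w {..<n}"
  proof (rule inj_onI)
    fix i j assume ij: "i \<in> {..<n}" "j \<in> {..<n}" "w i = w j"
    then have "(row i, col (inv \<rho> i)) = (row j, col (inv \<rho> j))"
      using w(2,3)[of i] w(2,3)[of j] by simp
    then show "i = j" using inj_onD[OF True] ij by blast
  qed
  then have wp: "w permutes {..<n}"
    using w by (intro inj_imp_permutes) (auto simp: w_def)
  have "w \<in> R" using wp w by (simp add: R_def)
  moreover have "w \<circ> \<rho> \<in> C"
    unfolding C_def using permutes_compose[OF \<rho> wp] w(3) permutes_in_image[OF \<rho>] permutes_inverses(2)[OF \<rho>]
    by auto
  moreover have "\<rho> = inv w \<circ> (w \<circ> \<rho>)"
    using permutes_inverses(2)[OF wp] by (auto simp: fun_eq_iff)
  ultimately show ?thesis using product R_inv by blast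
next
  case False
  then obtain a b where ab: "a < n" "b < n" "a \<noteq> b" "row a = row b" "col (inv \<rho> a) = col (inv \<rho> b)"
    by (auto simp: inj_on_def)
  have eq: "inv \<rho> \<circ> transpose a b \<circ> \<rho> = transpose (inv \<rho> a) (inv \<rho> b)"
    using \<rho> by (auto simp: fun_eq_iff transpose_def permutes_inv_eq permutes_inverses)
  have "inv \<rho> a < n" "inv \<rho> b < n" "inv \<rho> a \<noteq> inv \<rho> b"
    using ab permutes_in_image[OF permutes_inv[OF \<rho>]] permutes_inverses(1)[OF \<rho>] by (auto, metis)
  then show ?thesis
    using ab by (intro swap[of "transpose a b"]) (simp_all add: eq R_transpose C_transpose sign_swap_id)
qed

end

text \<open>The permutations extending a given injection form a coset of the symmetric group on
  {k..<n}, which gives the factor (n - k)!.\<close>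

lemma sum_permutations_restrict:
  fixes W :: "(nat \<Rightarrow> nat) \<Rightarrow> complex"
  assumes "k \<le> n"
  shows "(\<Sum>f | f permutes {..<n}. W (restrict f {..<k})) =
    fact (n - k) * (\<Sum>h | h \<in> {..<k} \<rightarrow>\<^sub>E {..<n} \<and> inj_on h {..<k}. W h)"
proof -
  let ?P = "{f. f permutes {..<n}}" and ?I = "{h. h \<in> {..<k} \<rightarrow>\<^sub>E {..<n} \<and> inj_on h {..<k}}"
  have finI: "finite ?I" by (rule finite_subset[of _ "{..<k} \<rightarrow>\<^sub>E {..<n}"]) (auto intro: finite_PiE)
  have img: "(\<lambda>f. restrict f {..<k}) ` ?P \<subseteq> ?I"
  proof (rule image_subsetI)
    fix f assume "f \<in> ?P"
    then have f: "f permutes {..<n}" by simp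
    show "restrict f {..<k} \<in> ?I"
      using permutes_in_image[OF f] permutes_inj[OF f] assms by (auto simp: inj_on_def)
  qed
  have fiber: "card {f \<in> ?P. restrict f {..<k} = h} = fact (n - k)" if "h \<in> ?I" for h
  proof -
    have h: "h \<in> {..<k} \<rightarrow>\<^sub>E {..<n}" "inj_on h {..<k}" using that by auto
    have hsub: "h ` {..<k} \<subseteq> {..<n}" using h(1) by auto
    have "card ({..<n} - h ` {..<k}) = n - k"
      using hsub h(2) by (simp add: card_Diff_subset card_image)
    then obtain e where e: "bij_betw e {k..<n} ({..<n} - h ` {..<k})"
      using finite_same_card_bij[of "{k..<n}" "{..<n} - h ` {..<k}"] by auto
    define f1 where "f1 x = (if x < k then h x else if x < n then e x else x)" for x
    have "bij_betw f1 ({..<k} \<union> {k..<n}) (h ` {..<k} \<union> ({..<n} - h ` {..<k}))"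
    proof (rule bij_betw_combine)
      show "bij_betw f1 {..<k} (h ` {..<k})"
        using h(2) by (subst bij_betw_cong[of _ _ h]) (auto simp: f1_def bij_betw_def)
      show "bij_betw f1 {k..<n} ({..<n} - h ` {..<k})"
        using e by (subst bij_betw_cong[of _ _ e]) (auto simp: f1_def)
    qed auto
    moreover have "{..<k} \<union> {k..<n} = {..<n}" "h ` {..<k} \<union> ({..<n} - h ` {..<k}) = {..<n}"
      using assms hsub by auto
    ultimately have f1: "f1 permutes {..<n}"
      by (intro bij_imp_permutes) (auto simp: f1_def)
    have "{f \<in> ?P. restrict f {..<k} = h} = (\<lambda>u. f1 \<circ> u) ` {u. u permutes {k..<n}}"
    proof (intro equalityI subsetI)
      fix f assume "f \<in> {f \<in> ?P. restrict f {..<k} = h}"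
      then have f: "f permutes {..<n}" "restrict f {..<k} = h" by auto
      have "inv f1 \<circ> f permutes {..<n}" by (rule permutes_compose[OF f(1) permutes_inv[OF f1]])
      moreover have "(inv f1 \<circ> f) x = x" if "x < k" for x
      proof -
        have "f x = f1 x" using fun_cong[OF f(2), of x] that by (simp add: f1_def)
        then show ?thesis by (simp add: permutes_inverses(2)[OF f1])
      qed
      ultimately have "inv f1 \<circ> f permutes {k..<n}"
        by (rule permutes_superset) auto
      moreover have "f = f1 \<circ> (inv f1 \<circ> f)" using permutes_inverses(1)[OF f1] by (auto simp: fun_eq_iff)
      ultimately show "f \<in> (\<lambda>u. f1 \<circ> u) ` {u. u permutes {k..<n}}" by blast
    next
      fix f assume "f \<in> (\<lambda>u. f1 \<circ> u) ` {u. u permutes {k..<n}}"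
      then obtain u where u: "u permutes {k..<n}" "f = f1 \<circ> u" by blast
      have "u permutes {..<n}" by (rule permutes_subset[OF u(1)]) auto
      then have "f permutes {..<n}" unfolding u(2) by (rule permutes_compose[OF _ f1])
      moreover have "restrict f {..<k} = h"
        using permutes_not_in[OF u(1)] h(1) by (auto simp: fun_eq_iff u(2) f1_def PiE_def extensional_def)
      ultimately show "f \<in> {f \<in> ?P. restrict f {..<k} = h}" by blast
    qed
    moreover have "inj_on (\<lambda>u. f1 \<circ> u) {u. u permutes {k..<n}}"
      using permutes_inj[OF f1] by (auto simp: inj_on_def fun_eq_iff)
    ultimately show ?thesis
      by (simp add: card_image card_permutations)
  qed
  have "(\<Sum>f\<in>?P. W (restrict f {..<k})) = (\<Sum>h\<in>?I. \<Sum>f\<in>{f \<in> ?P. restrict f {..<k} = h}. W (restrict f {..<k}))"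
    using img by (intro sum.group[symmetric] finI finite_permutations) auto
  also have "\<dots> = (\<Sum>h\<in>?I. fact (n - k) * W h)"
  proof (rule sum.cong[OF refl])
    fix h assume "h \<in> ?I"
    have "(\<Sum>f\<in>{f \<in> ?P. restrict f {..<k} = h}. W (restrict f {..<k})) = (\<Sum>f\<in>{f \<in> ?P. restrict f {..<k} = h}. W h)"
      by (rule sum.cong) auto
    then show "(\<Sum>f\<in>{f \<in> ?P. restrict f {..<k} = h}. W (restrict f {..<k})) = fact (n - k) * W h"
      using fiber[OF \<open>h \<in> ?I\<close>] by simp
  qed
  finally show ?thesis by (simp add: sum_distrib_left)
qed

section \<open>Traces on left ideals of the group algebra\<close>

lemma alg_mult_superset:
  assumes "finite A" "finite B" "Poly_Mapping.keys x \<subseteq> A" "Poly_Mapping.keys y \<subseteq> B"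
  shows "alg_mult x y = (\<Sum>\<sigma>\<in>A. \<Sum>\<tau>\<in>B.
    Poly_Mapping.single (\<sigma> \<circ> \<tau>) (Poly_Mapping.lookup x \<sigma> * Poly_Mapping.lookup y \<tau>))"
proof -
  have "alg_mult x y = (\<Sum>\<sigma>\<in>Poly_Mapping.keys x. \<Sum>\<tau>\<in>B.
      Poly_Mapping.single (\<sigma> \<circ> \<tau>) (Poly_Mapping.lookup x \<sigma> * Poly_Mapping.lookup y \<tau>))"
    unfolding alg_mult_def using assms
    by (intro sum.cong refl sum.mono_neutral_left) (auto simp: in_keys_iff)
  also have "\<dots> = (\<Sum>\<sigma>\<in>A. \<Sum>\<tau>\<in>B.
      Poly_Mapping.single (\<sigma> \<circ> \<tau>) (Poly_Mapping.lookup x \<sigma> * Poly_Mapping.lookup y \<tau>))"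
    using assms by (intro sum.mono_neutral_left) (auto simp: in_keys_iff)
  finally show ?thesis .
qed

lemma alg_mult_add_left: "alg_mult (x + x') y = alg_mult x y + alg_mult x' y"
proof -
  let ?A = "Poly_Mapping.keys x \<union> Poly_Mapping.keys x'" and ?B = "Poly_Mapping.keys y"
  have "Poly_Mapping.keys (x + x') \<subseteq> ?A" by (rule keys_add)
  then show ?thesis
    by (simp add: alg_mult_superset[of ?A ?B] lookup_add distrib_right single_add sum.distrib)
qed

lemma alg_mult_add_right: "alg_mult x (y + y') = alg_mult x y + alg_mult x y'"
proof -
  let ?A = "Poly_Mapping.keys x" and ?B = "Poly_Mapping.keys y \<union> Poly_Mapping.keys y'"
  have "Poly_Mapping.keys (y + y') \<subseteq> ?B" by (rule keys_add)
  then show ?thesis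
    by (simp add: alg_mult_superset[of ?A ?B] lookup_add distrib_left single_add sum.distrib)
qed

lemma alg_mult_0: "alg_mult 0 y = 0" "alg_mult x 0 = 0"
  by (simp_all add: alg_mult_def)

lemma alg_mult_sum_left: "alg_mult (\<Sum>i\<in>I. f i) y = (\<Sum>i\<in>I. alg_mult (f i) y)"
  by (induction I rule: infinite_finite_induct) (auto simp: alg_mult_0 alg_mult_add_left)

lemma alg_mult_sum_right: "alg_mult x (\<Sum>i\<in>I. f i) = (\<Sum>i\<in>I. alg_mult x (f i))"
  by (induction I rule: infinite_finite_induct) (auto simp: alg_mult_0 alg_mult_add_right)

lemma alg_scale_single: "alg_scale c (Poly_Mapping.single \<sigma> d) = Poly_Mapping.single \<sigma> (c * d)"
  by (rule poly_mapping_eqI) (simp add: lookup_single when_def)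

lemma keys_alg_scale: "Poly_Mapping.keys (alg_scale c x) \<subseteq> Poly_Mapping.keys x"
  by (auto simp: in_keys_iff)

lemma alg_mult_scale_left: "alg_mult (alg_scale c x) y = alg_scale c (alg_mult x y)"
  using keys_alg_scale[of c x]
  by (simp add: alg_mult_superset[of "Poly_Mapping.keys x" "Poly_Mapping.keys y"]
      perm_alg.scale_sum_right alg_scale_single mult.assoc)

lemma alg_mult_scale_right: "alg_mult x (alg_scale c y) = alg_scale c (alg_mult x y)"
  using keys_alg_scale[of c y]
  by (simp add: alg_mult_superset[of "Poly_Mapping.keys x" "Poly_Mapping.keys y"]
      perm_alg.scale_sum_right alg_scale_single mult.left_commute)

lemma alg_mult_single:
  "alg_mult (Poly_Mapping.single \<sigma> c) (Poly_Mapping.single \<tau> d) = Poly_Mapping.single (\<sigma> \<circ> \<tau>) (c * d)"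
  by (subst alg_mult_superset[of "{\<sigma>}" "{\<tau>}"]) (auto simp: lookup_single)

lemma alg_mult_assoc: "alg_mult (alg_mult x y) z = alg_mult x (alg_mult y z)"
proof -
  let ?s = "\<lambda>x \<sigma>. Poly_Mapping.single \<sigma> (Poly_Mapping.lookup x \<sigma>)"
  have "alg_mult (alg_mult (\<Sum>\<sigma>\<in>Poly_Mapping.keys x. ?s x \<sigma>) (\<Sum>\<sigma>\<in>Poly_Mapping.keys y. ?s y \<sigma>)) (\<Sum>\<sigma>\<in>Poly_Mapping.keys z. ?s z \<sigma>)
      = alg_mult (\<Sum>\<sigma>\<in>Poly_Mapping.keys x. ?s x \<sigma>) (alg_mult (\<Sum>\<sigma>\<in>Poly_Mapping.keys y. ?s y \<sigma>) (\<Sum>\<sigma>\<in>Poly_Mapping.keys z. ?s z \<sigma>))"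
    by (simp only: alg_mult_sum_left alg_mult_sum_right alg_mult_single comp_assoc mult.assoc)
  then show ?thesis by (simp flip: poly_mapping_sum_single)
qed

lemma lookup_single_alg_mult:
  assumes "bij \<sigma>"
  shows "Poly_Mapping.lookup (alg_mult (Poly_Mapping.single \<sigma> 1) y) \<rho> = Poly_Mapping.lookup y (inv \<sigma> \<circ> \<rho>)"
proof -
  have eq: "\<sigma> \<circ> \<tau> = \<rho> \<longleftrightarrow> \<tau> = inv \<sigma> \<circ> \<rho>" for \<tau>
    by (simp add: fun_eq_iff bij_inv_eq_iff[OF assms])
  have "alg_mult (Poly_Mapping.single \<sigma> 1) y =
      (\<Sum>\<tau>\<in>Poly_Mapping.keys y. Poly_Mapping.single (\<sigma> \<circ> \<tau>) (Poly_Mapping.lookup y \<tau>))"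
    by (subst alg_mult_superset[of "{\<sigma>}" "Poly_Mapping.keys y"]) auto
  then show ?thesis
    by (auto simp: lookup_sum lookup_single when_def eq in_keys_iff)
qed

lemma lookup_alg_mult_single:
  assumes "bij \<tau>"
  shows "Poly_Mapping.lookup (alg_mult y (Poly_Mapping.single \<tau> 1)) \<rho> = Poly_Mapping.lookup y (\<rho> \<circ> inv \<tau>)"
proof -
  have eq: "\<sigma> \<circ> \<tau> = \<rho> \<longleftrightarrow> \<sigma> = \<rho> \<circ> inv \<tau>" for \<sigma>
    using assms by (auto simp: fun_eq_iff bij_is_inj bij_is_surj surj_f_inv_f) (metis bij_inv_eq_iff)
  have "alg_mult y (Poly_Mapping.single \<tau> 1) =
      (\<Sum>\<sigma>\<in>Poly_Mapping.keys y. Poly_Mapping.single (\<sigma> \<circ> \<tau>) (Poly_Mapping.lookup y \<sigma>))"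
    by (subst alg_mult_superset[of "Poly_Mapping.keys y" "{\<tau>}"]) auto
  then show ?thesis
    by (auto simp: lookup_sum lookup_single when_def eq in_keys_iff)
qed

lemma group_algebra_single: "\<sigma> permutes {..<n} \<Longrightarrow> Poly_Mapping.single \<sigma> c \<in> group_algebra n"
  by (auto simp: group_algebra_def sym_group_def)

lemma group_algebra_add: "x \<in> group_algebra n \<Longrightarrow> y \<in> group_algebra n \<Longrightarrow> x + y \<in> group_algebra n"
  using keys_add[of x y] by (auto simp: group_algebra_def)

lemma group_algebra_scale: "x \<in> group_algebra n \<Longrightarrow> alg_scale c x \<in> group_algebra n"
  using keys_alg_scale[of c x] by (auto simp: group_algebra_def)

lemma group_algebra_0: "0 \<in> group_algebra n"
  by (simp add: group_algebra_def)

lemma group_algebra_sum: "(\<And>i. i \<in> I \<Longrightarrow> f i \<in> group_algebra n) \<Longrightarrow> (\<Sum>i\<in>I. f i) \<in> group_algebra n"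
  by (induction I rule: infinite_finite_induct) (auto simp: group_algebra_0 group_algebra_add)

lemma group_algebra_mult:
  assumes "x \<in> group_algebra n" "y \<in> group_algebra n"
  shows "alg_mult x y \<in> group_algebra n"
  unfolding alg_mult_def using assms
  by (intro group_algebra_sum group_algebra_single)
     (auto simp: group_algebra_def sym_group_def intro: permutes_compose)

lemma finite_sym_group: "finite (sym_group n)"
  by (simp add: sym_group_def finite_permutations)

lemma group_algebra_expand:
  assumes "x \<in> group_algebra n"
  shows "x = (\<Sum>g\<in>sym_group n. alg_scale (Poly_Mapping.lookup x g) (Poly_Mapping.single g 1))"
proof -
  have "x = (\<Sum>g\<in>Poly_Mapping.keys x. alg_scale (Poly_Mapping.lookup x g) (Poly_Mapping.single g 1))"
    by (simp add: alg_scale_single flip: poly_mapping_sum_single)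
  also have "\<dots> = (\<Sum>g\<in>sym_group n. alg_scale (Poly_Mapping.lookup x g) (Poly_Mapping.single g 1))"
    using assms by (intro sum.mono_neutral_left finite_sym_group)
      (auto simp: group_algebra_def in_keys_iff)
  finally show ?thesis .
qed

text \<open>Right multiplication by e maps the group algebra onto the left ideal and is \<gamma>
  on it, so the trace on the ideal can be computed on the whole group algebra, in the basis of
  permutations.\<close>

lemma trace_on_left_ideal:
  assumes e: "e \<in> group_algebra n" "alg_mult e e = alg_scale \<gamma> e" and \<pi>: "\<pi> permutes {..<n}"
  shows "\<gamma> * trace_on ((\<lambda>x. alg_mult x e) ` group_algebra n) (alg_mult (Poly_Mapping.single \<pi> 1)) =
    (\<Sum>g\<in>sym_group n. Poly_Mapping.lookup e (inv g \<circ> inv \<pi> \<circ> g))"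
proof -
  define V where "V = (\<lambda>x. alg_mult x e) ` group_algebra n"
  have "perm_alg.subspace V"
  proof (rule perm_alg.subspaceI)
    show "0 \<in> V" unfolding V_def by (rule image_eqI[OF _ group_algebra_0]) (simp add: alg_mult_0)
    show "x + y \<in> V" if xy: "x \<in> V" "y \<in> V" for x y
    proof -
      obtain a b where "x = alg_mult a e" "a \<in> group_algebra n" "y = alg_mult b e" "b \<in> group_algebra n"
        using xy unfolding V_def by blast
      then show ?thesis
        unfolding V_def by (intro image_eqI[of _ _ "a + b"]) (simp_all add: alg_mult_add_left group_algebra_add)
    qed
    show "alg_scale c x \<in> V" if x: "x \<in> V" for c x
    proof -
      obtain a where "x = alg_mult a e" "a \<in> group_algebra n"
        using x unfolding V_def by blast
      then show ?thesis
        unfolding V_def by (intro image_eqI[of _ _ "alg_scale c a"]) (simp_all add: alg_mult_scale_left group_algebra_scale)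
    qed
  qed
  then have ex: "\<exists>B. perm_alg.independent B \<and> perm_alg.span B = V"
    by (metis perm_alg.basis_exists perm_alg.span_minimal subset_antisym)
  define B where "B = (SOME B. perm_alg.independent B \<and> perm_alg.span B = V)"
  have B: "perm_alg.independent B" "perm_alg.span B = V"
    using someI_ex[OF ex] by (simp_all add: B_def)
  have tr: "trace_on V (alg_mult (Poly_Mapping.single \<pi> 1)) =
      (\<Sum>b\<in>B. perm_alg.representation B (alg_mult (Poly_Mapping.single \<pi> 1) b) b)"
    by (simp add: trace_on_def B_def Let_def)
  have V_sub: "V \<subseteq> group_algebra n"
    using group_algebra_mult e(1) by (auto simp: V_def)
  have B_sub: "B \<subseteq> V" using perm_alg.span_superset[of B] B(2) by simp
  have finB: "finite B"
  proof -
    let ?T = "(\<lambda>g. Poly_Mapping.single g (1::complex)) ` sym_group n"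
    have "group_algebra n \<subseteq> perm_alg.span ?T"
    proof
      fix x assume "x \<in> group_algebra n"
      from group_algebra_expand[OF this] show "x \<in> perm_alg.span ?T"
        by (metis (mono_tags, lifting) imageI perm_alg.span_base perm_alg.span_scale perm_alg.span_sum)
    qed
    then have "B \<subseteq> perm_alg.span ?T" using B_sub V_sub by blast
    then show ?thesis
      using perm_alg.independent_span_bound[OF _ B(1), of ?T] finite_sym_group by blast
  qed
  \<comment> \<open>The map x to \<pi> x e sends the whole algebra into \<open>V\<close>, and on
    \<open>V\<close> it is \<gamma> times left multiplication by \<pi>.\<close>
  define T where "T x = alg_mult (alg_mult (Poly_Mapping.single \<pi> 1) x) e" for x
  let ?s = "\<lambda>g. Poly_Mapping.single g (1::complex)"
  have T_V: "T x \<in> V" if "x \<in> group_algebra n" for x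
    using group_algebra_mult[OF group_algebra_single[OF \<pi>] that] by (auto simp: T_def V_def)
  have T_s: "T (?s g) \<in> V" if "g \<in> sym_group n" for g
    using that by (intro T_V group_algebra_single) (simp add: sym_group_def)
  have T_expand: "T x = (\<Sum>g\<in>sym_group n. alg_scale (Poly_Mapping.lookup x g) (T (?s g)))"
    if "x \<in> group_algebra n" for x
    by (subst group_algebra_expand[OF that])
       (simp add: T_def alg_mult_sum_left alg_mult_sum_right alg_mult_scale_left alg_mult_scale_right)
  have T_b: "T b = alg_scale \<gamma> (alg_mult (?s \<pi>) b)" if "b \<in> V" for b
  proof -
    from that obtain x where "b = alg_mult x e" by (auto simp: V_def)
    then have "alg_mult b e = alg_scale \<gamma> b"
      by (simp add: alg_mult_assoc e(2) alg_mult_scale_right)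
    then show ?thesis by (simp add: T_def alg_mult_assoc alg_mult_scale_right)
  qed
  have left_V: "alg_mult (?s \<pi>) b \<in> V" if "b \<in> V" for b
    using that group_algebra_mult[OF group_algebra_single[OF \<pi>]]
    by (auto simp: V_def simp flip: alg_mult_assoc)
  \<comment> \<open>The identity tr(AB) = tr(BA) for the passage between the two bases: the diagonal
    coefficients in the basis of permutations are expanded over \<open>B\<close>, and the double sum
    is exchanged.\<close>
  have "(\<Sum>g\<in>sym_group n. Poly_Mapping.lookup (T (?s g)) g) =
      (\<Sum>g\<in>sym_group n. \<Sum>b\<in>B. perm_alg.representation B (T (?s g)) b * Poly_Mapping.lookup b g)"
  proof (rule sum.cong[OF refl])
    fix g assume "g \<in> sym_group n"
    then have "T (?s g) = (\<Sum>b\<in>B. alg_scale (perm_alg.representation B (T (?s g)) b) b)"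
      using perm_alg.sum_representation_eq[OF B(1) _ finB order_refl, of "T (?s g)"] T_s B(2) by simp
    then have "Poly_Mapping.lookup (T (?s g)) g =
        Poly_Mapping.lookup (\<Sum>b\<in>B. alg_scale (perm_alg.representation B (T (?s g)) b) b) g" by simp
    then show "Poly_Mapping.lookup (T (?s g)) g = (\<Sum>b\<in>B. perm_alg.representation B (T (?s g)) b * Poly_Mapping.lookup b g)"
      by (simp add: lookup_sum)
  qed
  also have "\<dots> = (\<Sum>b\<in>B. \<Sum>g\<in>sym_group n. Poly_Mapping.lookup b g * perm_alg.representation B (T (?s g)) b)"
    by (subst sum.swap) (simp add: mult.commute)
  also have "\<dots> = (\<Sum>b\<in>B. perm_alg.representation B (T b) b)"
  proof (rule sum.cong[OF refl])
    fix b assume "b \<in> B"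
    then have "T b = (\<Sum>g\<in>sym_group n. alg_scale (Poly_Mapping.lookup b g) (T (?s g)))"
      using B_sub V_sub by (intro T_expand) blast
    moreover have "perm_alg.representation B (\<Sum>g\<in>sym_group n. alg_scale (Poly_Mapping.lookup b g) (T (?s g))) b =
        (\<Sum>g\<in>sym_group n. Poly_Mapping.lookup b g * perm_alg.representation B (T (?s g)) b)"
    proof -
      have span: "T (?s g) \<in> perm_alg.span B" if "g \<in> sym_group n" for g
        using T_s[OF that] B(2) by simp
      show ?thesis
        by (simp add: span perm_alg.representation_sum[OF B(1)] perm_alg.representation_scale[OF B(1)] perm_alg.span_scale)
    qed
    ultimately show "(\<Sum>g\<in>sym_group n. Poly_Mapping.lookup b g * perm_alg.representation B (T (?s g)) b) =
        perm_alg.representation B (T b) b" by simp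
  qed
  also have "\<dots> = \<gamma> * trace_on V (alg_mult (?s \<pi>))"
    unfolding tr sum_distrib_left
  proof (rule sum.cong[OF refl])
    fix b assume "b \<in> B"
    then have "b \<in> V" using B_sub by blast
    then show "perm_alg.representation B (T b) b = \<gamma> * perm_alg.representation B (alg_mult (?s \<pi>) b) b"
      using left_V B by (simp add: T_b perm_alg.representation_scale)
  qed
  finally have "\<gamma> * trace_on V (alg_mult (?s \<pi>)) = (\<Sum>g\<in>sym_group n. Poly_Mapping.lookup (T (?s g)) g)" by simp
  \<comment> \<open>The coefficient of g in \<pi> g e is that of g^-1 \<pi>^-1 g in e. Hence the
    factorizations below are those of the inverse cycle.\<close>
  also have "\<dots> = (\<Sum>g\<in>sym_group n. Poly_Mapping.lookup e (inv g \<circ> inv \<pi> \<circ> g))"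
  proof (rule sum.cong[OF refl])
    fix g assume "g \<in> sym_group n"
    then have bij: "bij \<pi>" "bij g" using \<pi> by (auto simp: sym_group_def intro: permutes_bij)
    then show "Poly_Mapping.lookup (T (?s g)) g = Poly_Mapping.lookup e (inv g \<circ> inv \<pi> \<circ> g)"
      by (simp add: T_def alg_mult_single lookup_single_alg_mult bij_comp o_inv_distrib)
  qed
  finally show ?thesis by (simp add: V_def)
qed

section \<open>The Young symmetrizer\<close>

lemma sum_involution_zero:
  fixes w :: "'a \<Rightarrow> complex"
  assumes "\<And>x. x \<in> A \<Longrightarrow> i x \<in> A" "\<And>x. x \<in> A \<Longrightarrow> i (i x) = x" "\<And>x. x \<in> A \<Longrightarrow> w (i x) = - w x"
  shows "sum w A = 0"
proof -
  have "sum w A = (\<Sum>x\<in>A. - w x)"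
    by (rule sum.reindex_bij_witness[of _ i i]) (use assms in auto)
  then show ?thesis by (simp add: sum_negf)
qed

lemma sign_conjugate:
  assumes "finite S" "f permutes S" "\<tau> permutes S"
  shows "sign (f \<circ> \<tau> \<circ> inv f) = sign \<tau>"
  using assms permutes_imp_permutation[of S]
  by (simp add: sign_compose permutation_compose permutes_inv sign_inverse)

definition factorizations :: "nat \<Rightarrow> (nat \<Rightarrow> nat) \<Rightarrow> ((nat \<Rightarrow> nat) \<times> (nat \<Rightarrow> nat)) set" where
  "factorizations k \<rho> = {(\<sigma>, \<tau>). \<sigma> permutes {..<k} \<and> \<tau> permutes {..<k} \<and> \<sigma> \<circ> \<tau> = \<rho>}"

lemma finite_factorizations: "finite (factorizations k \<rho>)"
  by (rule finite_subset[of _ "{\<sigma>. \<sigma> permutes {..<k}} \<times> {\<sigma>. \<sigma> permutes {..<k}}"])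
     (auto simp: factorizations_def finite_permutations)

context numbered_diagram
begin

definition symmetrizer :: perm_alg where
  "symmetrizer = (\<Sum>\<sigma>\<in>R. \<Sum>\<tau>\<in>C. Poly_Mapping.single (\<sigma> \<circ> \<tau>) (of_int (sign \<tau>)))"

definition compatible :: "nat \<Rightarrow> (nat \<Rightarrow> nat) \<Rightarrow> (nat \<Rightarrow> nat) \<times> (nat \<Rightarrow> nat) \<Rightarrow> bool" where
  "compatible k f = (\<lambda>(\<sigma>, \<tau>). invariant_on {..<k} \<sigma> (row \<circ> f) \<and> invariant_on {..<k} \<tau> (col \<circ> f))"

text \<open>Deliberately defined for every map f: its vanishing at non-injective maps is what
  permits summation over all functions.\<close>

definition weight :: "nat \<Rightarrow> (nat \<Rightarrow> nat) \<Rightarrow> (nat \<Rightarrow> nat) \<Rightarrow> complex" where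
  "weight k \<rho> f = (\<Sum>(\<sigma>, \<tau>) | (\<sigma>, \<tau>) \<in> factorizations k \<rho> \<and> compatible k f (\<sigma>, \<tau>). of_int (sign \<tau>))"

lemma lookup_symmetrizer:
  "Poly_Mapping.lookup symmetrizer \<rho> = (\<Sum>(\<sigma>, \<tau>) | \<sigma> \<in> R \<and> \<tau> \<in> C \<and> \<sigma> \<circ> \<tau> = \<rho>. of_int (sign \<tau>))"
proof -
  have "Poly_Mapping.lookup symmetrizer \<rho> = (\<Sum>(\<sigma>, \<tau>)\<in>R \<times> C. if \<sigma> \<circ> \<tau> = \<rho> then of_int (sign \<tau>) else 0)"
    by (simp add: symmetrizer_def lookup_sum lookup_single when_def flip: sum.cartesian_product)
  also have "\<dots> = (\<Sum>p\<in>R \<times> C. if fst p \<circ> snd p = \<rho> then of_int (sign (snd p)) else 0)"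
    by (simp add: case_prod_beta)
  also have "\<dots> = (\<Sum>p\<in>{p \<in> R \<times> C. fst p \<circ> snd p = \<rho>}. of_int (sign (snd p)))"
    by (rule sum.inter_filter[symmetric]) (simp add: finite_R finite_C)
  also have "\<dots> = (\<Sum>(\<sigma>, \<tau>) | \<sigma> \<in> R \<and> \<tau> \<in> C \<and> \<sigma> \<circ> \<tau> = \<rho>. of_int (sign \<tau>))"
    by (rule sum.cong) auto
  finally show ?thesis .
qed

lemma symmetrizer_in_group_algebra: "symmetrizer \<in> group_algebra n"
  unfolding symmetrizer_def
  by (intro group_algebra_sum group_algebra_single) (auto simp: R_def C_def intro: permutes_compose)

text \<open>A point x fixed by \<rho> satisfies \<sigma> (\<tau> y) = y for y = f x, so that
  \<tau> y lies in the row and in the column of y; hence both factors fix y.\<close>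

lemma lookup_symmetrizer_conjugate:
  assumes f: "f permutes {..<n}" and \<rho>: "\<rho> permutes {..<k}" and "k \<le> n"
  shows "Poly_Mapping.lookup symmetrizer (f \<circ> \<rho> \<circ> inv f) = weight k \<rho> f"
  unfolding lookup_symmetrizer weight_def
proof (rule sum.reindex_bij_witness[where i = "\<lambda>(\<sigma>, \<tau>). (f \<circ> \<sigma> \<circ> inv f, f \<circ> \<tau> \<circ> inv f)"
      and j = "\<lambda>(\<sigma>, \<tau>). (inv f \<circ> \<sigma> \<circ> f, inv f \<circ> \<tau> \<circ> f)"])
  note finv = permutes_inverses[OF f]
  have invf: "inv f permutes {..<n}" by (rule permutes_inv[OF f])
  have f_lt: "f x < n \<longleftrightarrow> x < n" "inv f x < n \<longleftrightarrow> x < n" for x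
    using permutes_in_image[OF f] permutes_in_image[OF invf] by auto
  fix p assume "p \<in> {(\<sigma>, \<tau>). \<sigma> \<in> R \<and> \<tau> \<in> C \<and> \<sigma> \<circ> \<tau> = f \<circ> \<rho> \<circ> inv f}"
  then obtain \<sigma> \<tau> where p: "p = (\<sigma>, \<tau>)" "\<sigma> \<in> R" "\<tau> \<in> C" "\<sigma> \<circ> \<tau> = f \<circ> \<rho> \<circ> inv f" by auto
  have \<sigma>: "\<sigma> permutes {..<n}" and \<tau>: "\<tau> permutes {..<n}" using p by (auto simp: R_def C_def)
  have prod: "\<sigma> (\<tau> y) = f (\<rho> (inv f y))" for y using fun_cong[OF p(4)] by simp
  have fix_pt: "\<tau> (f x) = f x \<and> \<sigma> (f x) = f x" if "x \<in> {..<n} - {..<k}" for x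
  proof -
    let ?y = "f x"
    have y: "?y < n" "\<tau> ?y < n" using that f_lt permutes_in_image[OF \<tau>, of ?y] by auto
    have "\<sigma> (\<tau> ?y) = ?y" using prod[of ?y] permutes_not_in[OF \<rho>, of x] that by (simp add: finv)
    then have "row (\<tau> ?y) = row ?y" using p(2) y by (auto simp: R_def)
    moreover have "col (\<tau> ?y) = col ?y" using p(3) y by (auto simp: C_def)
    ultimately have "\<tau> ?y = ?y" using y cell_inj by blast
    with \<open>\<sigma> (\<tau> ?y) = ?y\<close> show ?thesis by simp
  qed
  have "inv f \<circ> \<sigma> \<circ> f permutes {..<k}"
    by (rule permutes_superset[of _ "{..<n}"]) (auto intro!: permutes_compose f \<sigma> invf simp: fix_pt finv)
  moreover have "inv f \<circ> \<tau> \<circ> f permutes {..<k}"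
    by (rule permutes_superset[of _ "{..<n}"]) (auto intro!: permutes_compose f \<tau> invf simp: fix_pt finv)
  moreover have "(inv f \<circ> \<sigma> \<circ> f) \<circ> (inv f \<circ> \<tau> \<circ> f) = \<rho>"
    by (simp add: fun_eq_iff finv prod)
  moreover have "compatible k f (inv f \<circ> \<sigma> \<circ> f, inv f \<circ> \<tau> \<circ> f)"
    using p(2,3) \<open>k \<le> n\<close> f_lt by (auto simp: compatible_def invariant_on_def finv R_def C_def)
  ultimately show "(case p of (\<sigma>, \<tau>) \<Rightarrow> (inv f \<circ> \<sigma> \<circ> f, inv f \<circ> \<tau> \<circ> f)) \<in>
      {(\<sigma>, \<tau>). (\<sigma>, \<tau>) \<in> factorizations k \<rho> \<and> compatible k f (\<sigma>, \<tau>)}"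
    by (simp add: p(1) factorizations_def)
  show "(case case p of (\<sigma>, \<tau>) \<Rightarrow> (inv f \<circ> \<sigma> \<circ> f, inv f \<circ> \<tau> \<circ> f) of
      (\<sigma>, \<tau>) \<Rightarrow> (f \<circ> \<sigma> \<circ> inv f, f \<circ> \<tau> \<circ> inv f)) = p"
    by (simp add: p(1) fun_eq_iff finv)
  have "sign (inv f \<circ> \<tau> \<circ> f) = sign \<tau>"
    using sign_conjugate[OF _ invf \<tau>] by (simp add: permutes_inv_inv[OF f])
  then show "(case case p of (\<sigma>, \<tau>) \<Rightarrow> (inv f \<circ> \<sigma> \<circ> f, inv f \<circ> \<tau> \<circ> f) of (\<sigma>, \<tau>) \<Rightarrow> of_int (sign \<tau>)) =
      (case p of (\<sigma>, \<tau>) \<Rightarrow> of_int (sign \<tau>))"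
    by (simp add: p(1))
next
  note finv = permutes_inverses[OF f]
  have invf: "inv f permutes {..<n}" by (rule permutes_inv[OF f])
  fix p assume "p \<in> {(\<sigma>, \<tau>). (\<sigma>, \<tau>) \<in> factorizations k \<rho> \<and> compatible k f (\<sigma>, \<tau>)}"
  then obtain \<sigma> \<tau> where p: "p = (\<sigma>, \<tau>)" "\<sigma> permutes {..<k}" "\<tau> permutes {..<k}" "\<sigma> \<circ> \<tau> = \<rho>"
    and inv: "\<And>i. i < k \<Longrightarrow> row (f (\<sigma> i)) = row (f i)" "\<And>i. i < k \<Longrightarrow> col (f (\<tau> i)) = col (f i)"
    by (auto simp: factorizations_def compatible_def invariant_on_def)
  have \<sigma>: "\<sigma> permutes {..<n}" and \<tau>: "\<tau> permutes {..<n}"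
    using p permutes_subset[of _ "{..<k}" "{..<n}"] \<open>k \<le> n\<close> by auto
  have "row (f (\<sigma> (inv f j))) = row j" for j
    using inv(1)[of "inv f j"] permutes_not_in[OF p(2), of "inv f j"] finv(1)
    by (cases "inv f j < k") auto
  moreover have "col (f (\<tau> (inv f j))) = col j" for j
    using inv(2)[of "inv f j"] permutes_not_in[OF p(3), of "inv f j"] finv(1)
    by (cases "inv f j < k") auto
  ultimately have "f \<circ> \<sigma> \<circ> inv f \<in> R" "f \<circ> \<tau> \<circ> inv f \<in> C"
    by (auto simp: R_def C_def intro!: permutes_compose f \<sigma> \<tau> invf)
  moreover have "(f \<circ> \<sigma> \<circ> inv f) \<circ> (f \<circ> \<tau> \<circ> inv f) = f \<circ> \<rho> \<circ> inv f"
    by (simp add: fun_eq_iff finv flip: p(4))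
  ultimately show "(case p of (\<sigma>, \<tau>) \<Rightarrow> (f \<circ> \<sigma> \<circ> inv f, f \<circ> \<tau> \<circ> inv f)) \<in>
      {(\<sigma>, \<tau>). \<sigma> \<in> R \<and> \<tau> \<in> C \<and> \<sigma> \<circ> \<tau> = f \<circ> \<rho> \<circ> inv f}"
    by (simp add: p(1))
  show "(case case p of (\<sigma>, \<tau>) \<Rightarrow> (f \<circ> \<sigma> \<circ> inv f, f \<circ> \<tau> \<circ> inv f) of
      (\<sigma>, \<tau>) \<Rightarrow> (inv f \<circ> \<sigma> \<circ> f, inv f \<circ> \<tau> \<circ> f)) = p"
    by (simp add: p(1) fun_eq_iff finv)
qed

text \<open>With k = 0 the general formulas specialize to the identity: the coefficient of
  \<open>id\<close> in the symmetrizer, and later the value n! for \<gamma> times the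
  dimension.\<close>

lemma weight_0: "weight 0 id f = 1"
proof -
  have "{(\<sigma>, \<tau>). (\<sigma>, \<tau>) \<in> factorizations 0 id \<and> compatible 0 f (\<sigma>, \<tau>)} = {(id, id)}"
    by (auto simp: factorizations_def compatible_def invariant_on_def)
  then show ?thesis by (simp add: weight_def)
qed

lemma lookup_symmetrizer_id: "Poly_Mapping.lookup symmetrizer id = 1"
  using lookup_symmetrizer_conjugate[of id id 0] by (simp add: permutes_id weight_0)

lemma lookup_symmetrizer_R:
  assumes "r \<in> R"
  shows "Poly_Mapping.lookup symmetrizer (r \<circ> \<rho>) = Poly_Mapping.lookup symmetrizer \<rho>"
proof -
  have r: "r permutes {..<n}" using assms by (simp add: R_def)
  show ?thesis
    unfolding lookup_symmetrizer
    by (rule sum.reindex_bij_witness[where i = "\<lambda>(\<sigma>, \<tau>). (r \<circ> \<sigma>, \<tau>)" and j = "\<lambda>(\<sigma>, \<tau>). (inv r \<circ> \<sigma>, \<tau>)"])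
       (auto simp: fun_eq_iff permutes_inverses[OF r] intro: R_comp R_inv assms)
qed

lemma lookup_symmetrizer_C:
  assumes "c \<in> C"
  shows "Poly_Mapping.lookup symmetrizer (\<rho> \<circ> c) = of_int (sign c) * Poly_Mapping.lookup symmetrizer \<rho>"
proof -
  have c: "c permutes {..<n}" using assms by (simp add: C_def)
  have sign: "sign (\<tau> \<circ> c) = sign \<tau> * sign c" if "\<tau> \<in> C" for \<tau>
    using that c permutes_imp_permutation[of "{..<n}"] by (auto simp: C_def sign_compose)
  have "Poly_Mapping.lookup symmetrizer (\<rho> \<circ> c) =
      (\<Sum>(\<sigma>, \<tau>) | \<sigma> \<in> R \<and> \<tau> \<in> C \<and> \<sigma> \<circ> \<tau> = \<rho>. of_int (sign c) * of_int (sign \<tau>))"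
    unfolding lookup_symmetrizer
    apply (rule sum.reindex_bij_witness[where i = "\<lambda>(\<sigma>, \<tau>). (\<sigma>, \<tau> \<circ> c)" and j = "\<lambda>(\<sigma>, \<tau>). (\<sigma>, \<tau> \<circ> inv c)"])
    subgoal by (auto simp: fun_eq_iff permutes_inverses[OF c])
    subgoal using C_comp[OF C_inv[OF assms]] C_comp assms by (auto simp: fun_eq_iff permutes_inverses[OF c] C_inv)
    subgoal by (auto simp: fun_eq_iff permutes_inverses[OF c])
    subgoal using C_comp assms by (auto simp: fun_eq_iff)
    subgoal for p
      using sign[of "snd p \<circ> inv c"] C_comp[OF _ C_inv[OF assms], of "snd p"]
      by (auto simp: permutes_inv_o[OF c] comp_assoc simp flip: of_int_mult)
    done
  then show ?thesis by (simp add: lookup_symmetrizer sum_distrib_left case_prod_beta)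
qed

text \<open>Both e and e * e are invariant under \<open>R\<close> on the left and transform by the
  sign under \<open>C\<close> on the right. By the dichotomy such an element is determined by its
  coefficient at \<open>id\<close>, which for e is 1; so \<gamma> is the coefficient of
  \<open>id\<close> in e * e.\<close>

lemma symmetrizer_quasi_idempotent:
  "\<exists>\<gamma>. alg_mult symmetrizer symmetrizer = alg_scale \<gamma> symmetrizer"
proof
  let ?e = symmetrizer
  define y where "y = alg_mult ?e ?e"
  \<comment> \<open>Multiplication by a permutation shifts coefficients by its inverse, hence the
    products with \<open>inv r\<close> here and \<open>inv c\<close> below.\<close>
  have left: "Poly_Mapping.lookup y (r \<circ> \<rho>) = Poly_Mapping.lookup y \<rho>" if "r \<in> R" for r \<rho>
  proof -
    have bij: "bij (inv r)" and inv: "inv (inv r) = r"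
      using that permutes_bij permutes_inv permutes_inv_inv by (auto simp: R_def)
    have "alg_mult (Poly_Mapping.single (inv r) 1) ?e = ?e"
      using that by (intro poly_mapping_eqI) (simp add: lookup_single_alg_mult[OF bij] inv lookup_symmetrizer_R)
    then have "alg_mult (Poly_Mapping.single (inv r) 1) y = y"
      by (simp add: y_def flip: alg_mult_assoc)
    then show ?thesis
      using lookup_single_alg_mult[OF bij, of y \<rho>] by (simp add: inv)
  qed
  have right: "Poly_Mapping.lookup y (\<rho> \<circ> c) = of_int (sign c) * Poly_Mapping.lookup y \<rho>" if "c \<in> C" for c \<rho>
  proof -
    have bij: "bij (inv c)" and inv: "inv (inv c) = c"
      using that permutes_bij permutes_inv permutes_inv_inv by (auto simp: C_def)
    have "alg_mult ?e (Poly_Mapping.single (inv c) 1) = alg_scale (of_int (sign c)) ?e"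
      using that by (intro poly_mapping_eqI) (simp add: lookup_alg_mult_single[OF bij] inv lookup_symmetrizer_C)
    then have "alg_mult y (Poly_Mapping.single (inv c) 1) = alg_scale (of_int (sign c)) y"
      by (simp add: y_def alg_mult_assoc alg_mult_scale_right)
    then show ?thesis
      using lookup_alg_mult_single[OF bij, of y \<rho>] by (simp add: inv)
  qed
  \<comment> \<open>The element t \<rho> = \<rho> (\<rho>^-1 t \<rho>) is read in two ways: the
    first keeps the coefficient at \<rho>, the second reverses its sign.\<close>
  have zero: "Poly_Mapping.lookup x \<rho> = 0"
    if "t \<in> R" "inv \<rho> \<circ> t \<circ> \<rho> \<in> C" "sign (inv \<rho> \<circ> t \<circ> \<rho>) = -1" "\<rho> permutes {..<n}"
      and "\<And>r \<rho>. r \<in> R \<Longrightarrow> Poly_Mapping.lookup x (r \<circ> \<rho>) = Poly_Mapping.lookup x \<rho>"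
      and "\<And>c \<rho>. c \<in> C \<Longrightarrow> Poly_Mapping.lookup x (\<rho> \<circ> c) = of_int (sign c) * Poly_Mapping.lookup x \<rho>"
    for x :: perm_alg and t \<rho>
  proof -
    have "t \<circ> \<rho> = \<rho> \<circ> (inv \<rho> \<circ> t \<circ> \<rho>)"
      by (simp add: fun_eq_iff permutes_inverses[OF that(4)])
    then have "Poly_Mapping.lookup x \<rho> = - Poly_Mapping.lookup x \<rho>"
      using that(5)[OF that(1), of \<rho>] that(6)[OF that(2), of \<rho>] that(3) by simp
    then show ?thesis by simp
  qed
  show "alg_mult ?e ?e = alg_scale (Poly_Mapping.lookup y id) ?e"
  proof (rule poly_mapping_eqI)
    fix \<rho>
    show "Poly_Mapping.lookup (alg_mult ?e ?e) \<rho> = Poly_Mapping.lookup (alg_scale (Poly_Mapping.lookup y id) ?e) \<rho>"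
    proof (cases "\<rho> permutes {..<n}")
      case True
      then show ?thesis
      proof (cases rule: von_neumann_dichotomy)
        case (product r c)
        then show ?thesis
          using left[of r c] right[of c id] lookup_symmetrizer_R[of r c] lookup_symmetrizer_C[of c id]
          by (simp add: lookup_symmetrizer_id flip: y_def)
      next
        case (swap t)
        then show ?thesis
          using zero[OF swap True left right] zero[OF swap True lookup_symmetrizer_R lookup_symmetrizer_C]
          by (simp flip: y_def)
      qed
    next
      case False
      have "x \<in> group_algebra n \<Longrightarrow> Poly_Mapping.lookup x \<rho> = 0" for x
        using False by (auto simp: group_algebra_def sym_group_def in_keys_iff)
      then show ?thesis
        using symmetrizer_in_group_algebra by (simp add: group_algebra_mult)
    qed
  qed
qed

lemma weight_restrict: "weight k \<rho> (restrict f {..<k}) = weight k \<rho> f"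
proof -
  have "compatible k (restrict f {..<k}) p \<longleftrightarrow> compatible k f p" if fac: "p \<in> factorizations k \<rho>" for p
  proof -
    obtain \<sigma> \<tau> where p: "p = (\<sigma>, \<tau>)" "\<sigma> permutes {..<k}" "\<tau> permutes {..<k}"
      using fac by (auto simp: factorizations_def)
    then have "\<sigma> i < k \<and> \<tau> i < k" if "i < k" for i
      using permutes_in_image[OF p(2), of i] permutes_in_image[OF p(3), of i] that by simp
    then show ?thesis by (auto simp: p(1) compatible_def invariant_on_def)
  qed
  then show ?thesis unfolding weight_def by (intro sum.cong) auto
qed

text \<open>If f a = f b, exchanging the factorization (\<sigma>, \<tau>) with (\<sigma> (a b), (a
  b) \<tau>) reverses the sign.\<close>

lemma weight_not_inj:
  assumes "\<not> inj_on f {..<k}"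
  shows "weight k \<rho> f = 0"
proof -
  obtain a b where ab: "a < k" "b < k" "a \<noteq> b" "f a = f b"
    using assms by (auto simp: inj_on_def)
  let ?t = "transpose a b"
  have t: "?t permutes {..<k}" using ab by (simp add: permutes_swap_id)
  have ft: "f (?t i) = f i" for i using ab by (auto simp: transpose_def)
  have t_lt: "?t i < k" if "i < k" for i using permutes_in_image[OF t, of i] that by simp
  show ?thesis
    unfolding weight_def
  proof (rule sum_involution_zero[where i = "\<lambda>(\<sigma>, \<tau>). (\<sigma> \<circ> ?t, ?t \<circ> \<tau>)"])
    fix p assume "p \<in> {(\<sigma>, \<tau>). (\<sigma>, \<tau>) \<in> factorizations k \<rho> \<and> compatible k f (\<sigma>, \<tau>)}"
    then obtain \<sigma> \<tau> where p: "p = (\<sigma>, \<tau>)" "\<sigma> permutes {..<k}" "\<tau> permutes {..<k}" "\<sigma> \<circ> \<tau> = \<rho>" "compatible k f (\<sigma>, \<tau>)"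
      by (auto simp: factorizations_def)
    have "(\<sigma> \<circ> ?t) \<circ> (?t \<circ> \<tau>) = \<rho>" by (simp add: fun_eq_iff flip: p(4))
    moreover have "compatible k f (\<sigma> \<circ> ?t, ?t \<circ> \<tau>)"
      using p(5) t_lt by (simp add: compatible_def invariant_on_def ft)
    ultimately show "(case p of (\<sigma>, \<tau>) \<Rightarrow> (\<sigma> \<circ> ?t, ?t \<circ> \<tau>)) \<in>
        {(\<sigma>, \<tau>). (\<sigma>, \<tau>) \<in> factorizations k \<rho> \<and> compatible k f (\<sigma>, \<tau>)}"
      using p(2,3) t by (simp add: p(1) factorizations_def permutes_compose)
    show "(case (case p of (\<sigma>, \<tau>) \<Rightarrow> (\<sigma> \<circ> ?t, ?t \<circ> \<tau>)) of (\<sigma>, \<tau>) \<Rightarrow> (\<sigma> \<circ> ?t, ?t \<circ> \<tau>)) = p"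
      by (simp add: p(1) fun_eq_iff)
    have "sign (?t \<circ> \<tau>) = - sign \<tau>"
      using ab permutes_imp_permutation[OF _ p(3)] by (simp add: sign_compose permutation_swap_id sign_swap_id)
    then show "(case (case p of (\<sigma>, \<tau>) \<Rightarrow> (\<sigma> \<circ> ?t, ?t \<circ> \<tau>)) of (\<sigma>, \<tau>) \<Rightarrow> of_int (sign \<tau>)) =
        - (case p of (\<sigma>, \<tau>) \<Rightarrow> complex_of_int (sign \<tau>))"
      by (simp add: p(1))
  qed
qed

text \<open>Each conjugate depends on only k values of the permutation, which gives (n - k)! times a
  sum over injections; the non-injective maps then add zero.\<close>

lemma sum_symmetrizer_conjugates:
  assumes "k \<le> n" and \<pi>: "\<pi> permutes {..<k}"
  shows "(\<Sum>g\<in>sym_group n. Poly_Mapping.lookup symmetrizer (inv g \<circ> inv \<pi> \<circ> g)) =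
    fact (n - k) * (\<Sum>h\<in>{..<k} \<rightarrow>\<^sub>E {..<n}. weight k (inv \<pi>) h)"
proof -
  have "(\<Sum>g\<in>sym_group n. Poly_Mapping.lookup symmetrizer (inv g \<circ> inv \<pi> \<circ> g)) =
      (\<Sum>g\<in>sym_group n. Poly_Mapping.lookup symmetrizer (g \<circ> inv \<pi> \<circ> inv g))"
    unfolding sym_group_def
    by (subst (2) sum_permutations_inverse) (auto intro!: sum.cong simp: permutes_inv_inv)
  also have "\<dots> = (\<Sum>f | f permutes {..<n}. weight k (inv \<pi>) (restrict f {..<k}))"
    unfolding sym_group_def using assms
    by (intro sum.cong refl) (simp add: lookup_symmetrizer_conjugate permutes_inv weight_restrict)
  also have "\<dots> = fact (n - k) * (\<Sum>h | h \<in> {..<k} \<rightarrow>\<^sub>E {..<n} \<and> inj_on h {..<k}. weight k (inv \<pi>) h)"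
    by (rule sum_permutations_restrict[OF \<open>k \<le> n\<close>])
  also have "(\<Sum>h | h \<in> {..<k} \<rightarrow>\<^sub>E {..<n} \<and> inj_on h {..<k}. weight k (inv \<pi>) h) =
      (\<Sum>h\<in>{..<k} \<rightarrow>\<^sub>E {..<n}. weight k (inv \<pi>) h)"
    by (intro sum.mono_neutral_left finite_PiE) (auto simp: weight_not_inj)
  finally show ?thesis .
qed

text \<open>The case k = 0 gives \<gamma> times the dimension as n!. So \<gamma> is nonzero and
  cancels from the quotient.\<close>

lemma character_ratio:
  assumes "k \<le> n" and \<pi>: "\<pi> permutes {..<k}"
  defines "V \<equiv> (\<lambda>x. alg_mult x symmetrizer) ` group_algebra n"
  shows "trace_on V (alg_mult (Poly_Mapping.single \<pi> 1)) / trace_on V (alg_mult (Poly_Mapping.single id 1)) =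
    fact (n - k) * (\<Sum>h\<in>{..<k} \<rightarrow>\<^sub>E {..<n}. weight k (inv \<pi>) h) / fact n"
proof -
  obtain \<gamma> where \<gamma>: "alg_mult symmetrizer symmetrizer = alg_scale \<gamma> symmetrizer"
    using symmetrizer_quasi_idempotent by blast
  have \<pi>n: "\<pi> permutes {..<n}" using \<pi> \<open>k \<le> n\<close> by (auto intro: permutes_subset)
  note tr = trace_on_left_ideal[OF symmetrizer_in_group_algebra \<gamma>, folded V_def]
  have "\<gamma> * trace_on V (alg_mult (Poly_Mapping.single id 1)) = fact n"
    using tr[of id] sum_symmetrizer_conjugates[of 0 id]
    by (simp add: permutes_id weight_0 card_PiE)
  moreover have "\<gamma> * trace_on V (alg_mult (Poly_Mapping.single \<pi> 1)) =
      fact (n - k) * (\<Sum>h\<in>{..<k} \<rightarrow>\<^sub>E {..<n}. weight k (inv \<pi>) h)"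
    using tr[OF \<pi>n] sum_symmetrizer_conjugates[OF assms(1,2)] by simp
  moreover have "\<gamma> \<noteq> 0" using calculation(1) by auto
  ultimately show ?thesis
    by (metis (no_types, lifting) mult_divide_mult_cancel_left)
qed

end

section \<open>The character polynomial\<close>

lemma length_diagram_cells: "length (diagram_cells \<omega>) = sum_list \<omega>"
proof -
  have "length (diagram_cells \<omega>) = sum_list (map (\<lambda>r. \<omega> ! r) [0..<length \<omega>])"
    by (simp add: diagram_cells_def length_concat comp_def)
  then show ?thesis by (simp add: map_nth)
qed

lemma set_diagram_cells: "set (diagram_cells \<omega>) = (SIGMA r:{..<length \<omega>}. {..<\<omega> ! r})"
  by (auto simp: diagram_cells_def)

lemma distinct_diagram_cells: "distinct (diagram_cells \<omega>)"
proof (rule card_distinct)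
  show "card (set (diagram_cells \<omega>)) = length (diagram_cells \<omega>)"
    by (simp add: set_diagram_cells length_diagram_cells sum_list_sum_nth atLeast0LessThan)
qed

lemma numbered_diagram_cells:
  "numbered_diagram (sum_list \<omega>) (length \<omega>) (\<lambda>j. fst (diagram_cells \<omega> ! j)) (\<lambda>j. snd (diagram_cells \<omega> ! j)) (\<lambda>r. \<omega> ! r)"
proof
  have "bij_betw (\<lambda>j. diagram_cells \<omega> ! j) {..<sum_list \<omega>} (SIGMA r:{..<length \<omega>}. {..<\<omega> ! r})"
    by (rule bij_betw_nth) (simp_all add: distinct_diagram_cells length_diagram_cells set_diagram_cells)
  then show "bij_betw (\<lambda>j. (fst (diagram_cells \<omega> ! j), snd (diagram_cells \<omega> ! j)))
      {..<sum_list \<omega>} (SIGMA r:{..<length \<omega>}. {..<\<omega> ! r})" by simp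
qed

lemma falling_factorial_mult_fact:
  "k \<le> n \<Longrightarrow> (\<Prod>i<k. of_nat (n - i)) * fact (n - k) = (fact n :: complex)"
proof (induction k)
  case (Suc k)
  then have "n - k = Suc (n - Suc k)" by simp
  then have "fact (n - k) = (of_nat (n - k) * fact (n - Suc k) :: complex)" by (metis fact_Suc)
  then show ?case using Suc by (simp add: mult.assoc)
qed simp

lemma (in numbered_diagram) sum_weight:
  "(\<Sum>h\<in>{..<k} \<rightarrow>\<^sub>E {..<n}. weight k \<rho> h) = (\<Sum>p\<in>factorizations k \<rho>.
     of_int (sign (snd p)) * of_nat (card {h \<in> {..<k} \<rightarrow>\<^sub>E {..<n}. compatible k h p}))"
proof -
  have "weight k \<rho> h = (\<Sum>p\<in>factorizations k \<rho>. if compatible k h p then of_int (sign (snd p)) else 0)" for h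
    unfolding weight_def using finite_factorizations
    by (subst sum.inter_filter[symmetric]) (auto simp: case_prod_beta intro!: sum.cong)
  then have "(\<Sum>h\<in>{..<k} \<rightarrow>\<^sub>E {..<n}. weight k \<rho> h) =
      (\<Sum>p\<in>factorizations k \<rho>. \<Sum>h\<in>{..<k} \<rightarrow>\<^sub>E {..<n}. if compatible k h p then of_int (sign (snd p)) else 0)"
    by (simp add: sum.swap[of _ "{..<k} \<rightarrow>\<^sub>E {..<n}"])
  also have "\<dots> = (\<Sum>p\<in>factorizations k \<rho>.
     of_int (sign (snd p)) * of_nat (card {h \<in> {..<k} \<rightarrow>\<^sub>E {..<n}. compatible k h p}))"
    by (intro sum.cong refl, subst sum.inter_filter[symmetric]) (auto intro: finite_PiE)
  finally show ?thesis .
qed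

definition long_cycle :: "nat \<Rightarrow> nat \<Rightarrow> nat" where
  "long_cycle k = cycle_of_list [0..<k]"

text \<open>The falling factorial in the normalization cancels the factor (n - k)! / n! of the
  character ratio, leaving a plain signed count.\<close>

lemma normalized_character_eq:
  fixes \<omega> :: "nat list"
  defines "n \<equiv> sum_list \<omega>"
  assumes "k \<le> n"
  shows "normalized_character \<omega> k = (\<Sum>p\<in>factorizations k (inv (long_cycle k)).
     of_int (sign (snd p)) * of_nat (card {h \<in> {..<k} \<rightarrow>\<^sub>E {..<n}.
       numbered_diagram.compatible (\<lambda>j. fst (diagram_cells \<omega> ! j)) (\<lambda>j. snd (diagram_cells \<omega> ! j)) k h p}))"
proof -
  interpret numbered_diagram n "length \<omega>" "\<lambda>j. fst (diagram_cells \<omega> ! j)" "\<lambda>j. snd (diagram_cells \<omega> ! j)" "\<lambda>r. \<omega> ! r"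
    unfolding n_def by (rule numbered_diagram_cells)
  have "row_group \<omega> = R" "column_group \<omega> = C"
    unfolding row_group_def column_group_def R_def C_def sym_group_def n_def[symmetric] by auto
  then have V: "specht_module \<omega> = (\<lambda>x. alg_mult x symmetrizer) ` group_algebra n"
    unfolding specht_module_def young_symmetrizer_def symmetrizer_def n_def[symmetric] by simp
  have "long_cycle k permutes {..<k}"
    using cycle_permutes[of "[0..<k]"] by (simp add: long_cycle_def atLeast0LessThan)
  from character_ratio[OF \<open>k \<le> n\<close> this]
  have ratio: "irr_character \<omega> (long_cycle k) / irr_character \<omega> id =
      fact (n - k) * (\<Sum>h\<in>{..<k} \<rightarrow>\<^sub>E {..<n}. weight k (inv (long_cycle k)) h) / fact n"
    by (simp add: irr_character_def V)
  have "normalized_character \<omega> k = (\<Prod>i<k. of_nat (n - i)) *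
      (irr_character \<omega> (long_cycle k) / irr_character \<omega> id)"
    by (simp add: normalized_character_def n_def long_cycle_def)
  then have "normalized_character \<omega> k = (\<Prod>i<k. of_nat (n - i)) *
      (fact (n - k) * (\<Sum>h\<in>{..<k} \<rightarrow>\<^sub>E {..<n}. weight k (inv (long_cycle k)) h) / fact n)"
    by (simp only: ratio)
  also have "\<dots> = (\<Prod>i<k. of_nat (n - i)) * fact (n - k) * (\<Sum>h\<in>{..<k} \<rightarrow>\<^sub>E {..<n}. weight k (inv (long_cycle k)) h) / fact n"
    by simp
  also have "\<dots> = (\<Sum>h\<in>{..<k} \<rightarrow>\<^sub>E {..<n}. weight k (inv (long_cycle k)) h)"
    unfolding falling_factorial_mult_fact[OF \<open>k \<le> n\<close>] by simp
  finally show ?thesis unfolding sum_weight .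
qed

text \<open>A placement splits into its row coordinates \<alpha> and column coordinates \<beta>.
  \<sigma> constrains only \<alpha>, \<tau> only \<beta>, and the two interact solely through the
  row lengths.\<close>

lemma (in numbered_diagram) card_compatible:
  assumes \<sigma>: "\<sigma> permutes {..<k}" and \<tau>: "\<tau> permutes {..<k}"
  shows "card {h \<in> {..<k} \<rightarrow>\<^sub>E {..<n}. compatible k h (\<sigma>, \<tau>)} =
    (\<Sum>\<alpha> | \<alpha> \<in> {..<k} \<rightarrow>\<^sub>E {..<l} \<and> invariant_on {..<k} \<sigma> \<alpha>.
       card {\<beta> \<in> (\<Pi>\<^sub>E i\<in>{..<k}. {..<len (\<alpha> i)}). invariant_on {..<k} \<tau> \<beta>})"
proof -
  let ?H = "{h \<in> {..<k} \<rightarrow>\<^sub>E {..<n}. compatible k h (\<sigma>, \<tau>)}"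
  let ?A = "{\<alpha>. \<alpha> \<in> {..<k} \<rightarrow>\<^sub>E {..<l} \<and> invariant_on {..<k} \<sigma> \<alpha>}"
  let ?B = "\<lambda>\<alpha>. {\<beta> \<in> (\<Pi>\<^sub>E i\<in>{..<k}. {..<len (\<alpha> i)}). invariant_on {..<k} \<tau> \<beta>}"
  define F where "F h = (restrict (row \<circ> h) {..<k}, restrict (col \<circ> h) {..<k})" for h :: "nat \<Rightarrow> nat"
  have lt: "\<sigma> i < k" "\<tau> i < k" if "i < k" for i
    using permutes_in_image[OF \<sigma>, of i] permutes_in_image[OF \<tau>, of i] that by simp_all
  have "bij_betw F ?H (Sigma ?A ?B)"
  proof (rule bij_betw_imageI)
    show "inj_on F ?H"
    proof (rule inj_onI)
      fix h h' assume h: "h \<in> ?H" "h' \<in> ?H" "F h = F h'"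
      show "h = h'"
      proof (rule PiE_ext)
        show "h \<in> {..<k} \<rightarrow>\<^sub>E {..<n}" "h' \<in> {..<k} \<rightarrow>\<^sub>E {..<n}" using h by auto
        fix i assume i: "i \<in> {..<k}"
        have eq: "fst (F h) i = fst (F h') i" "snd (F h) i = snd (F h') i" using h(3) by simp_all
        have "h i < n" "h' i < n" using h(1,2) i by auto
        moreover have "row (h i) = row (h' i)" "col (h i) = col (h' i)" using eq i by (simp_all add: F_def)
        ultimately show "h i = h' i" using cell_inj by blast
      qed
    qed
    show "F ` ?H = Sigma ?A ?B"
    proof (intro equalityI subsetI)
      fix x assume "x \<in> F ` ?H"
      then obtain h where h: "h \<in> ?H" "x = F h" by blast
      then have "h i < n" if "i < k" for i using that by auto
      then show "x \<in> Sigma ?A ?B"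
        using h lt row_lt col_lt by (auto simp: F_def compatible_def invariant_on_def)
    next
      fix x assume "x \<in> Sigma ?A ?B"
      then obtain \<alpha> \<beta> where x: "x = (\<alpha>, \<beta>)" "\<alpha> \<in> ?A" "\<beta> \<in> ?B \<alpha>" by blast
      have "\<exists>j<n. row j = \<alpha> i \<and> col j = \<beta> i" if "i < k" for i
        using x that by (intro cell_surj) auto
      then obtain h0 where h0: "\<And>i. i < k \<Longrightarrow> h0 i < n \<and> row (h0 i) = \<alpha> i \<and> col (h0 i) = \<beta> i"
        by metis
      define h where "h = restrict h0 {..<k}"
      have "h \<in> ?H"
        using x h0 lt by (auto simp: h_def compatible_def invariant_on_def)
      moreover have "F h = x"
        using x h0 by (auto simp: F_def h_def fun_eq_iff PiE_def extensional_def)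
      ultimately show "x \<in> F ` ?H" by blast
    qed
  qed
  then have "card ?H = card (Sigma ?A ?B)" by (rule bij_betw_same_card)
  also have "\<dots> = (\<Sum>\<alpha>\<in>?A. card (?B \<alpha>))"
  proof (rule card_SigmaI)
    show "finite ?A" by (rule finite_subset[of _ "{..<k} \<rightarrow>\<^sub>E {..<l}"]) (auto intro: finite_PiE)
    show "\<forall>\<alpha>\<in>?A. finite (?B \<alpha>)"
    proof
      fix \<alpha>
      have fin: "finite (\<Pi>\<^sub>E i\<in>{..<k}. {..<len (\<alpha> i)})" by (rule finite_PiE) simp_all
      show "finite (?B \<alpha>)" by (rule finite_subset[OF _ fin]) blast
    qed
  qed
  finally show ?thesis .
qed

section \<open>Counting placements in the shape p x q\<close>

definition colourings :: "nat \<Rightarrow> nat \<Rightarrow> (nat \<Rightarrow> nat) \<Rightarrow> (nat \<Rightarrow> nat) set" where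
  "colourings m k \<sigma> = {\<phi> \<in> {..<k} \<rightarrow>\<^sub>E {1..m}. invariant_on {..<k} \<sigma> \<phi>}"

lemma finite_colourings: "finite (colourings m k \<sigma>)"
  by (rule finite_subset[of _ "{..<k} \<rightarrow>\<^sub>E {1..m}"]) (auto simp: colourings_def intro: finite_PiE)

text \<open>As q decreases, the shortest row belongs to the largest index. This is the origin of
  \<open>Max\<close> in \<open>char_poly\<close>.\<close>

lemma card_Inter_lessThan_antimono:
  fixes q :: "nat \<Rightarrow> nat"
  assumes "finite Z" "Z \<noteq> {}" "\<phi> ` Z \<subseteq> {1..m}"
    and q: "\<And>i j. i \<in> {1..m} \<Longrightarrow> j \<in> {1..m} \<Longrightarrow> i < j \<Longrightarrow> q j < q i"
  shows "card (\<Inter>x\<in>Z. {..<q (\<phi> x)}) = q (Max (\<phi> ` Z))"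
proof -
  have Max: "Max (\<phi> ` Z) \<in> \<phi> ` Z" using assms by (intro Max_in) auto
  have "q (Max (\<phi> ` Z)) \<le> q (\<phi> x)" if "x \<in> Z" for x
  proof -
    have "\<phi> x \<le> Max (\<phi> ` Z)" using assms(1) that by simp
    moreover have "\<phi> x \<in> {1..m}" "Max (\<phi> ` Z) \<in> {1..m}" using Max assms(3) that by blast+
    ultimately show ?thesis using q[of "\<phi> x" "Max (\<phi> ` Z)"] by (metis order_le_less)
  qed
  then have "(\<Inter>x\<in>Z. {..<q (\<phi> x)}) = {..<q (Max (\<phi> ` Z))}"
    using Max by fastforce
  then show ?thesis by simp
qed

text \<open>The rows of length q i form the i-th block; a row assignment is counted through the
  blocks \<phi> it uses, and a column is available to an orbit of \<tau> if it meets the shortest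
  row used there.\<close>

lemma sum_row_assignments:
  fixes q :: "nat \<Rightarrow> nat" and bl :: "nat list"
  assumes \<sigma>: "\<sigma> permutes {..<k}" and \<tau>: "\<tau> permutes {..<k}" and bl: "set bl \<subseteq> {1..m}"
    and q: "\<And>i j. i \<in> {1..m} \<Longrightarrow> j \<in> {1..m} \<Longrightarrow> i < j \<Longrightarrow> q j < q i"
  shows "(\<Sum>\<alpha> | \<alpha> \<in> {..<k} \<rightarrow>\<^sub>E {..<length bl} \<and> invariant_on {..<k} \<sigma> \<alpha>.
       card {\<beta> \<in> (\<Pi>\<^sub>E i\<in>{..<k}. {..<q (bl ! \<alpha> i)}). invariant_on {..<k} \<tau> \<beta>}) =
    (\<Sum>\<phi>\<in>colourings m k \<sigma>. (\<Prod>Z\<in>orbits_on {..<k} \<sigma>. card {r. r < length bl \<and> bl ! r = Max (\<phi> ` Z)}) *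
       (\<Prod>Z\<in>orbits_on {..<k} \<tau>. q (Max (\<phi> ` Z))))"
proof -
  let ?A = "{\<alpha>. \<alpha> \<in> {..<k} \<rightarrow>\<^sub>E {..<length bl} \<and> invariant_on {..<k} \<sigma> \<alpha>}"
  let ?c = "\<lambda>\<phi>. \<Prod>Z\<in>orbits_on {..<k} \<tau>. q (Max (\<phi> ` Z))"
  define F where "F \<alpha> = (\<lambda>i\<in>{..<k}. bl ! \<alpha> i)" for \<alpha>
  have lt: "\<sigma> i < k" if "i < k" for i using permutes_in_image[OF \<sigma>, of i] that by simp
  have finA: "finite ?A" by (rule finite_subset[of _ "{..<k} \<rightarrow>\<^sub>E {..<length bl}"]) (auto intro: finite_PiE)
  have img: "F ` ?A \<subseteq> colourings m k \<sigma>"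
  proof (rule image_subsetI)
    fix \<alpha> assume \<alpha>: "\<alpha> \<in> ?A"
    then have "bl ! \<alpha> i \<in> {1..m}" if "i < k" for i
      using bl nth_mem[of "\<alpha> i" bl] that by (auto simp: PiE_def Pi_def simp del: nth_mem)
    then show "F \<alpha> \<in> colourings m k \<sigma>"
      using \<alpha> lt by (auto simp: F_def colourings_def invariant_on_def)
  qed
  have inner: "card {\<beta> \<in> (\<Pi>\<^sub>E i\<in>{..<k}. {..<q (bl ! \<alpha> i)}). invariant_on {..<k} \<tau> \<beta>} = ?c (F \<alpha>)"
    if "\<alpha> \<in> ?A" for \<alpha>
  proof -
    have "(\<Pi>\<^sub>E i\<in>{..<k}. {..<q (bl ! \<alpha> i)}) = (\<Pi>\<^sub>E i\<in>{..<k}. {..<q (F \<alpha> i)})"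
      by (rule PiE_cong) (simp add: F_def)
    then have "card {\<beta> \<in> (\<Pi>\<^sub>E i\<in>{..<k}. {..<q (bl ! \<alpha> i)}). invariant_on {..<k} \<tau> \<beta>} =
        (\<Prod>Z\<in>orbits_on {..<k} \<tau>. card (\<Inter>x\<in>Z. {..<q (F \<alpha> x)}))"
      using card_invariant_functions[OF _ \<tau>, of "\<lambda>i. {..<q (F \<alpha> i)}"] by simp
    also have "\<dots> = ?c (F \<alpha>)"
    proof (rule prod.cong[OF refl])
      fix Z assume Z: "Z \<in> orbits_on {..<k} \<tau>"
      have sub: "Z \<subseteq> {..<k}" by (rule orbits_on_subset[OF \<tau> Z])
      have "F \<alpha> ` Z \<subseteq> {1..m}" using img that sub by (auto simp: colourings_def)
      then show "card (\<Inter>x\<in>Z. {..<q (F \<alpha> x)}) = q (Max (F \<alpha> ` Z))"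
        using sub orbits_on_nonempty[OF Z] q
        by (intro card_Inter_lessThan_antimono) (auto intro: finite_subset)
    qed
    finally show ?thesis .
  qed
  have fiber: "card {\<alpha> \<in> ?A. F \<alpha> = \<phi>} = (\<Prod>Z\<in>orbits_on {..<k} \<sigma>. card {r. r < length bl \<and> bl ! r = Max (\<phi> ` Z)})"
    if "\<phi> \<in> colourings m k \<sigma>" for \<phi>
  proof -
    have \<phi>: "\<phi> \<in> {..<k} \<rightarrow>\<^sub>E {1..m}" "invariant_on {..<k} \<sigma> \<phi>" using that by (auto simp: colourings_def)
    have "{\<alpha> \<in> ?A. F \<alpha> = \<phi>} = {\<alpha> \<in> (\<Pi>\<^sub>E i\<in>{..<k}. {r. r < length bl \<and> bl ! r = \<phi> i}). invariant_on {..<k} \<sigma> \<alpha>}"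
      using \<phi>(1) by (auto simp: F_def fun_eq_iff PiE_def Pi_def extensional_def)
    also have "card \<dots> = (\<Prod>Z\<in>orbits_on {..<k} \<sigma>. card (\<Inter>x\<in>Z. {r. r < length bl \<and> bl ! r = \<phi> x}))"
      by (rule card_invariant_functions[OF _ \<sigma>]) simp
    also have "\<dots> = (\<Prod>Z\<in>orbits_on {..<k} \<sigma>. card {r. r < length bl \<and> bl ! r = Max (\<phi> ` Z)})"
    proof (rule prod.cong[OF refl])
      fix Z assume Z: "Z \<in> orbits_on {..<k} \<sigma>"
      then obtain z where z: "z \<in> Z" using orbits_on_nonempty by blast
      \<comment> \<open>On an orbit of \<sigma> the colouring is constant, so \<open>Max\<close>
        merely reads off its value; on orbits of \<tau> it makes a genuine choice.\<close>
      have const: "\<phi> x = \<phi> z" if "x \<in> Z" for x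
        by (rule invariant_on_orbits_on[OF \<sigma> \<phi>(2) Z z that])
      have "\<phi> ` Z = (\<lambda>_. \<phi> z) ` Z" by (rule image_cong[OF refl const])
      moreover have "Z \<noteq> {}" using z by blast
      ultimately have "Max (\<phi> ` Z) = \<phi> z" by (simp add: image_constant_conv)
      moreover have "(\<Inter>x\<in>Z. {r. r < length bl \<and> bl ! r = \<phi> x}) = (\<Inter>x\<in>Z. {r. r < length bl \<and> bl ! r = \<phi> z})"
        by (intro INF_cong refl) (simp only: const)
      moreover have "Z \<noteq> {}" using z by blast
      ultimately show "card (\<Inter>x\<in>Z. {r. r < length bl \<and> bl ! r = \<phi> x}) = card {r. r < length bl \<and> bl ! r = Max (\<phi> ` Z)}"
        by simp
    qed
    finally show ?thesis .
  qed
  have "(\<Sum>\<alpha>\<in>?A. card {\<beta> \<in> (\<Pi>\<^sub>E i\<in>{..<k}. {..<q (bl ! \<alpha> i)}). invariant_on {..<k} \<tau> \<beta>}) = (\<Sum>\<alpha>\<in>?A. ?c (F \<alpha>))"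
    by (rule sum.cong[OF refl inner])
  also have "\<dots> = (\<Sum>\<phi>\<in>colourings m k \<sigma>. \<Sum>\<alpha>\<in>{\<alpha> \<in> ?A. F \<alpha> = \<phi>}. ?c (F \<alpha>))"
    by (rule sum.group[symmetric, OF finA finite_colourings img])
  also have "\<dots> = (\<Sum>\<phi>\<in>colourings m k \<sigma>. \<Sum>\<alpha>\<in>{\<alpha> \<in> ?A. F \<alpha> = \<phi>}. ?c \<phi>)"
    by (intro sum.cong refl) simp
  also have "\<dots> = (\<Sum>\<phi>\<in>colourings m k \<sigma>. (\<Prod>Z\<in>orbits_on {..<k} \<sigma>. card {r. r < length bl \<and> bl ! r = Max (\<phi> ` Z)}) * ?c \<phi>)"
    by (rule sum.cong[OF refl]) (simp only: sum_constant fiber of_nat_id)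
  finally show ?thesis .
qed

text \<open>Records for each row its block index instead of its length, so that multiplicities (p)
  and lengths (q) can be treated separately.\<close>

definition blocks :: "nat \<Rightarrow> (nat \<Rightarrow> nat) \<Rightarrow> nat list" where
  "blocks m p = concat (map (\<lambda>i. replicate (p i) i) [1..<Suc m])"

lemma shape_eq_blocks: "shape m p q = map q (blocks m p)"
  by (simp add: shape_def blocks_def map_concat comp_def)

lemma set_blocks: "set (blocks m p) \<subseteq> {1..m}"
  by (auto simp: blocks_def)

lemma blocks_Suc: "blocks (Suc m) p = blocks m p @ replicate (p (Suc m)) (Suc m)"
  by (simp add: blocks_def)

lemma card_block:
  assumes "i \<in> {1..m}"
  shows "card {r. r < length (blocks m p) \<and> blocks m p ! r = i} = p i"
proof -
  have "length (filter (\<lambda>x. x = i) (blocks m p)) = (if i \<in> {1..m} then p i else 0)"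
  proof (induction m)
    case 0
    show ?case by (simp add: blocks_def)
  next
    case (Suc m)
    then show ?case by (auto simp: blocks_Suc filter_replicate)
  qed
  then show ?thesis using assms by (simp add: length_filter_conv_card)
qed

lemma sum_list_shape: "sum_list (shape m p q) = (\<Sum>i = 1..m. p i * q i)"
proof (induction m)
  case 0
  show ?case by (simp add: shape_def)
next
  case (Suc m)
  then show ?case by (simp add: shape_eq_blocks blocks_Suc sum_list_replicate)
qed

text \<open>The Stanley-Feray formula. A colouring \<phi> selects the block of rows for each point,
  hence must be constant on orbits of \<sigma>.\<close>

definition char_poly :: "nat \<Rightarrow> nat \<Rightarrow> pq_poly" where
  "char_poly m k = (\<Sum>(\<sigma>, \<tau>)\<in>factorizations k (inv (long_cycle k)). Const (of_int (sign \<tau>)) *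
     (\<Sum>\<phi>\<in>colourings m k \<sigma>. (\<Prod>Z\<in>orbits_on {..<k} \<sigma>. p_ind (Max (\<phi> ` Z))) *
        (\<Prod>Z\<in>orbits_on {..<k} \<tau>. q_ind (Max (\<phi> ` Z)))))"

lemma Max_colouring:
  assumes "\<phi> \<in> colourings m k \<sigma>" "\<rho> permutes {..<k}" "Z \<in> orbits_on {..<k} \<rho>"
  shows "Max (\<phi> ` Z) \<in> {1..m}"
proof -
  have sub: "Z \<subseteq> {..<k}" by (rule orbits_on_subset[OF assms(2,3)])
  have "Max (\<phi> ` Z) \<in> \<phi> ` Z"
    using sub orbits_on_nonempty[OF assms(3)] by (intro Max_in) (auto intro: finite_subset)
  then show ?thesis using assms(1) sub by (auto simp: colourings_def)
qed

lemma p_ind_in_polys_in: "i \<in> {1..m} \<Longrightarrow> p_ind i \<in> polys_in m"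
  and q_ind_in_polys_in: "i \<in> {1..m} \<Longrightarrow> q_ind i \<in> polys_in m"
  by (simp_all add: polys_in_Var pq_vars_def)

lemma poly_eval_Const: "rat_hom \<phi> \<Longrightarrow> poly_eval \<phi> x (Const c) = \<phi> c"
  by (simp only: Const_def poly_eval_single) (simp add: monom_eval_def)

lemma char_poly_in_polys_in: "char_poly m k \<in> polys_in m"
  unfolding char_poly_def
proof (intro polys_in_sum, clarify)
  fix \<sigma> \<tau> assume "(\<sigma>, \<tau>) \<in> factorizations k (inv (long_cycle k))"
  then have "\<sigma> permutes {..<k}" "\<tau> permutes {..<k}" by (auto simp: factorizations_def)
  then show "Const (of_int (sign \<tau>)) *
     (\<Sum>\<phi>\<in>colourings m k \<sigma>. (\<Prod>Z\<in>orbits_on {..<k} \<sigma>. p_ind (Max (\<phi> ` Z))) *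
        (\<Prod>Z\<in>orbits_on {..<k} \<tau>. q_ind (Max (\<phi> ` Z)))) \<in> polys_in m"
    by (intro polys_in_mult polys_in_sum polys_in_prod p_ind_in_polys_in q_ind_in_polys_in
        Max_colouring polys_in_const)
qed

lemma poly_eval_char_poly:
  assumes adm: "admissible m p q" and k: "k \<le> (\<Sum>i = 1..m. p i * q i)"
  shows "of_rat (poly_eval id (pq_point p q) (char_poly m k)) = normalized_character (shape m p q) k"
proof -
  let ?\<omega> = "shape m p q" and ?bl = "blocks m p"
  interpret numbered_diagram "sum_list ?\<omega>" "length ?\<omega>" "\<lambda>j. fst (diagram_cells ?\<omega> ! j)"
      "\<lambda>j. snd (diagram_cells ?\<omega> ! j)" "\<lambda>r. ?\<omega> ! r"
    by (rule numbered_diagram_cells)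
  let ?N = "\<lambda>pr. card {h \<in> {..<k} \<rightarrow>\<^sub>E {..<sum_list ?\<omega>}. compatible k h pr}"
  have q: "q j < q i" if "i \<in> {1..m}" "j \<in> {1..m}" "i < j" for i j
    using adm that by (auto simp: admissible_def)
  have count: "?N (\<sigma>, \<tau>) = (\<Sum>\<phi>\<in>colourings m k \<sigma>. (\<Prod>Z\<in>orbits_on {..<k} \<sigma>. p (Max (\<phi> ` Z))) *
       (\<Prod>Z\<in>orbits_on {..<k} \<tau>. q (Max (\<phi> ` Z))))"
    if \<sigma>: "\<sigma> permutes {..<k}" and \<tau>: "\<tau> permutes {..<k}" for \<sigma> \<tau>
  proof -
    have "?N (\<sigma>, \<tau>) = (\<Sum>\<alpha> | \<alpha> \<in> {..<k} \<rightarrow>\<^sub>E {..<length ?bl} \<and> invariant_on {..<k} \<sigma> \<alpha>.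
       card {\<beta> \<in> (\<Pi>\<^sub>E i\<in>{..<k}. {..<q (?bl ! \<alpha> i)}). invariant_on {..<k} \<tau> \<beta>})"
      unfolding card_compatible[OF \<sigma> \<tau>]
    proof (rule sum.cong)
      fix \<alpha> assume "\<alpha> \<in> {\<alpha>. \<alpha> \<in> {..<k} \<rightarrow>\<^sub>E {..<length ?bl} \<and> invariant_on {..<k} \<sigma> \<alpha>}"
      then have "(\<Pi>\<^sub>E i\<in>{..<k}. {..<?\<omega> ! \<alpha> i}) = (\<Pi>\<^sub>E i\<in>{..<k}. {..<q (?bl ! \<alpha> i)})"
        by (intro PiE_cong) (auto simp: shape_eq_blocks PiE_def Pi_def)
      then show "card {\<beta> \<in> (\<Pi>\<^sub>E i\<in>{..<k}. {..<?\<omega> ! \<alpha> i}). invariant_on {..<k} \<tau> \<beta>} =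
          card {\<beta> \<in> (\<Pi>\<^sub>E i\<in>{..<k}. {..<q (?bl ! \<alpha> i)}). invariant_on {..<k} \<tau> \<beta>}" by simp
    qed (simp add: shape_eq_blocks)
    also have "\<dots> = (\<Sum>\<phi>\<in>colourings m k \<sigma>. (\<Prod>Z\<in>orbits_on {..<k} \<sigma>. card {r. r < length ?bl \<and> ?bl ! r = Max (\<phi> ` Z)}) *
       (\<Prod>Z\<in>orbits_on {..<k} \<tau>. q (Max (\<phi> ` Z))))"
      using set_blocks q by (rule sum_row_assignments[OF \<sigma> \<tau>])
    also have "\<dots> = (\<Sum>\<phi>\<in>colourings m k \<sigma>. (\<Prod>Z\<in>orbits_on {..<k} \<sigma>. p (Max (\<phi> ` Z))) *
       (\<Prod>Z\<in>orbits_on {..<k} \<tau>. q (Max (\<phi> ` Z))))"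
      by (intro sum.cong refl arg_cong2[of _ _ _ _ "(*)"] prod.cong card_block Max_colouring[OF _ \<sigma>])
    finally show ?thesis .
  qed
  have "poly_eval id (pq_point p q) (char_poly m k) =
      (\<Sum>(\<sigma>, \<tau>)\<in>factorizations k (inv (long_cycle k)). of_int (sign \<tau>) * of_nat (?N (\<sigma>, \<tau>)))"
    unfolding char_poly_def poly_eval_sum[OF rat_hom_id]
  proof (rule sum.cong[OF refl], clarify)
    fix \<sigma> \<tau> assume "(\<sigma>, \<tau>) \<in> factorizations k (inv (long_cycle k))"
    then have "\<sigma> permutes {..<k}" "\<tau> permutes {..<k}" by (auto simp: factorizations_def)
    then show "poly_eval id (pq_point p q) (Const (of_int (sign \<tau>)) *
     (\<Sum>\<phi>\<in>colourings m k \<sigma>. (\<Prod>Z\<in>orbits_on {..<k} \<sigma>. p_ind (Max (\<phi> ` Z))) *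
        (\<Prod>Z\<in>orbits_on {..<k} \<tau>. q_ind (Max (\<phi> ` Z))))) = of_int (sign \<tau>) * of_nat (?N (\<sigma>, \<tau>))"
      by (simp add: count poly_eval_mult poly_eval_sum poly_eval_prod poly_eval_Var poly_eval_Const rat_hom_id pq_point_def)
  qed
  then have "of_rat (poly_eval id (pq_point p q) (char_poly m k)) =
      (\<Sum>(\<sigma>, \<tau>)\<in>factorizations k (inv (long_cycle k)). of_int (sign \<tau>) * complex_of_nat (?N (\<sigma>, \<tau>)))"
    by (simp add: of_rat_sum of_rat_mult case_prod_beta)
  also have "\<dots> = normalized_character ?\<omega> k"
    using k by (subst normalized_character_eq) (simp_all add: sum_list_shape case_prod_beta)
  finally show ?thesis .
qed

text \<open>Existence is \<open>poly_eval_char_poly\<close>; for uniqueness, the difference of two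
  candidates vanishes at all admissible points of sufficient size.\<close>

lemma F_poly_eq:
  assumes "m \<ge> 1"
  shows "F_poly m k = char_poly m k"
  unfolding F_poly_def
proof (rule the_equality)
  fix f assume f: "f \<in> polys_in m \<and> (\<forall>p q. admissible m p q \<and> k \<le> (\<Sum>i = 1..m. p i * q i) \<longrightarrow>
        of_rat (poly_eval id (pq_point p q) f) = normalized_character (shape m p q) k)"
  have "f + - char_poly m k = 0"
  proof (rule polys_in_eq_0I[of _ m k])
    show "f + - char_poly m k \<in> polys_in m"
      using f char_poly_in_polys_in by (intro polys_in_add polys_in_uminus) auto
    fix p q assume "admissible m p q" "k \<le> (\<Sum>i = 1..m. p i * q i)"
    then have "(of_rat (poly_eval id (pq_point p q) f) :: complex) = of_rat (poly_eval id (pq_point p q) (char_poly m k))"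
      using f by (simp add: poly_eval_char_poly)
    then show "poly_eval id (pq_point p q) (f + - char_poly m k) = 0"
      by (simp add: poly_eval_add poly_eval_uminus rat_hom_id del: add_uminus_conv_diff)
  qed (rule assms)
  then show "f = char_poly m k" by simp
qed (simp add: char_poly_in_polys_in poly_eval_char_poly)

text \<open>The sign of \<tau> is (-1)^(k + number of its orbits), which cancels (-1)^k and the
  signs of the q's.\<close>

lemma F_poly_positive:
  assumes "m \<ge> 1"
  shows "pq_positive ((-1) ^ k * neg_q (F_poly m k))"
proof -
  have neg_Const: "neg_q (Const c) = Const c" for c
    by (simp add: neg_q_def poly_eval_Const rat_hom_Const)
  have "(-1) ^ k * neg_q (char_poly m k) = (\<Sum>(\<sigma>, \<tau>)\<in>factorizations k (inv (long_cycle k)).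
     \<Sum>\<phi>\<in>colourings m k \<sigma>. (\<Prod>Z\<in>orbits_on {..<k} \<sigma>. p_ind (Max (\<phi> ` Z))) *
        (\<Prod>Z\<in>orbits_on {..<k} \<tau>. q_ind (Max (\<phi> ` Z))))"
    unfolding char_poly_def neg_q_sum sum_distrib_left[of "(-1) ^ k" _ "factorizations k (inv (long_cycle k))"]
  proof (rule sum.cong[OF refl], clarify)
    fix \<sigma> \<tau> assume "(\<sigma>, \<tau>) \<in> factorizations k (inv (long_cycle k))"
    then have \<tau>: "\<tau> permutes {..<k}" by (auto simp: factorizations_def)
    let ?c = "card (orbits_on {..<k} \<tau>)"
    have Const_sign: "Const (of_int (sign \<tau>)) = (-1) ^ (k + ?c)"
    proof -
      have "Const ((-1) ^ j) = (-1) ^ j" for j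
        by (induction j) (simp_all add: Const_def mult_single[of 0 "-1" 0, simplified] single_uminus flip: single_one)
      then show ?thesis using sign_eq_orbits[OF _ \<tau>] by simp
    qed
    have neg_sign: "neg_q (Const (of_int (sign \<tau>))) = (-1) ^ (k + ?c)"
      by (rule trans[OF neg_Const Const_sign])
    have cancel: "(-1) ^ k * ((-1) ^ (k + ?c) * (x * ((-1) ^ ?c * y))) = x * y" for x y :: pq_poly
      by (simp add: power_add algebra_simps)
    show "(-1) ^ k * neg_q (Const (of_int (sign \<tau>)) *
      (\<Sum>\<phi>\<in>colourings m k \<sigma>. (\<Prod>Z\<in>orbits_on {..<k} \<sigma>. p_ind (Max (\<phi> ` Z))) *
        (\<Prod>Z\<in>orbits_on {..<k} \<tau>. q_ind (Max (\<phi> ` Z))))) =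
      (\<Sum>\<phi>\<in>colourings m k \<sigma>. (\<Prod>Z\<in>orbits_on {..<k} \<sigma>. p_ind (Max (\<phi> ` Z))) *
        (\<Prod>Z\<in>orbits_on {..<k} \<tau>. q_ind (Max (\<phi> ` Z))))"
      unfolding neg_q_ring_hom(4) neg_q_sum neg_q_prod neg_q_Var neg_sign prod_uminus sum_distrib_left
      by (rule sum.cong[OF refl cancel])
  qed
  then show ?thesis
    unfolding F_poly_eq[OF assms]
    by (auto intro!: pq_positive_sum pq_positive_mult pq_positive_prod pq_positive_Var)
qed

section \<open>Homogeneous parts under the change of sign of q\<close>

definition q_sign :: "pq_monom \<Rightarrow> rat" where
  "q_sign a = (\<Prod>v\<in>Poly_Mapping.keys a. case v of PVar i \<Rightarrow> 1 | QVar i \<Rightarrow> (-1) ^ Poly_Mapping.lookup a v)"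

lemma neg_q_single: "neg_q (Poly_Mapping.single a c) = Poly_Mapping.single a (q_sign a * c)"
proof -
  let ?x = "\<lambda>v. case v of PVar i \<Rightarrow> p_ind i | QVar i \<Rightarrow> - q_ind i"
  let ?s = "\<lambda>v. (case v of PVar i \<Rightarrow> 1 | QVar i \<Rightarrow> (-1) ^ Poly_Mapping.lookup a v) :: rat"
  have power_single: "Poly_Mapping.single (Poly_Mapping.single v 1) d ^ j = Poly_Mapping.single (Poly_Mapping.single v j) (d ^ j)"
    for v :: pq_var and d :: rat and j :: nat
    by (induction j) (simp_all add: mult_single flip: single_add)
  have "?x v ^ Poly_Mapping.lookup a v = Poly_Mapping.single (Poly_Mapping.single v (Poly_Mapping.lookup a v)) (?s v)" for v
    by (cases v) (simp_all only: Var_def single_uminus[symmetric] power_single pq_var.case power_one)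
  then have "monom_eval ?x a = (\<Prod>v\<in>Poly_Mapping.keys a. Poly_Mapping.single (Poly_Mapping.single v (Poly_Mapping.lookup a v)) (?s v))"
    by (simp add: monom_eval_def)
  also have "\<dots> = Poly_Mapping.single (\<Sum>v\<in>Poly_Mapping.keys a. Poly_Mapping.single v (Poly_Mapping.lookup a v)) (\<Prod>v\<in>Poly_Mapping.keys a. ?s v)"
    using finite_keys[of a] by (induction rule: finite_induct) (simp_all add: mult_single)
  finally have "monom_eval ?x a = Poly_Mapping.single a (q_sign a)"
    by (simp add: q_sign_def flip: poly_mapping_sum_single)
  then show ?thesis
    by (simp add: neg_q_def poly_eval_single[OF rat_hom_Const]) (simp add: Const_def mult_single mult.commute)
qed

text \<open>Changing the sign of q is diagonal in the monomials, so it commutes with taking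
  homogeneous parts. This bridges \<open>G_poly\<close>, cut out before the substitution, and the
  positivity of F after it.\<close>

lemma lookup_neg_q: "Poly_Mapping.lookup (neg_q f) a = q_sign a * Poly_Mapping.lookup f a"
proof -
  have "neg_q f = (\<Sum>b\<in>Poly_Mapping.keys f. Poly_Mapping.single b (q_sign b * Poly_Mapping.lookup f b))"
    by (subst poly_mapping_sum_single[of f]) (simp add: neg_q_sum neg_q_single)
  then show ?thesis
    by (auto simp: lookup_sum lookup_single when_def in_keys_iff sum.delta)
qed

lemma lookup_homogeneous_part:
  "Poly_Mapping.lookup (homogeneous_part d f) a = (if monom_degree a = d then Poly_Mapping.lookup f a else 0)"
  unfolding homogeneous_part_def
  by (auto simp: lookup_sum lookup_single when_def in_keys_iff sum.delta)

lemma lookup_minus_one_power_mult: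
  fixes f :: pq_poly
  shows "Poly_Mapping.lookup ((-1) ^ k * f) a = (-1) ^ k * Poly_Mapping.lookup f a"
  by (induction k) (simp_all add: mult.assoc)

theorem corollary4p5:
  fixes m k :: nat
  assumes "m \<ge> 1" and "k \<ge> 1"
  shows "pq_positive ((-1) ^ k * neg_q (R_poly m (k + 1)))
    \<and> pq_positive ((-1) ^ k * neg_q (G_poly m k))
    \<and> pq_positive (homogeneous_part (total_degree ((-1) ^ k * neg_q (F_poly m k)))
                     ((-1) ^ k * neg_q (F_poly m k)))"
proof (intro conjI)
  note F = F_poly_positive[OF assms(1), of k]
  show "pq_positive ((-1) ^ k * neg_q (R_poly m (k + 1)))"
    by (rule R_poly_positive)
  \<comment> \<open>Coefficientwise: in degree k + 1 the coefficients are those of (-1)^k F(p; -q),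
    in every other degree they are 0.\<close>
  show "pq_positive ((-1) ^ k * neg_q (G_poly m k))"
    using F by (simp add: pq_positive_iff G_poly_def lookup_minus_one_power_mult lookup_neg_q lookup_homogeneous_part)
  show "pq_positive (homogeneous_part (total_degree ((-1) ^ k * neg_q (F_poly m k))) ((-1) ^ k * neg_q (F_poly m k)))"
    by (rule pq_positive_homogeneous_part[OF F])
qed

end
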